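(* For any integer $n\geq 1$, the linear map $\tau\colon F_n\to F_n$ satisfies $$\|\tau\colon F_n\longrightarrow F_n\|_{cb}=\frac{n+1}{n}.$$
   Context: For $N\ge1$, let $\Lambda_N=\bigoplus_{0\leq k\leq N}\Lambda_{N,k}$ be the anti-symmetric Fock space over the complex Hilbert space $\ell^2_N$ with canonical basis $(e_1,\dots,e_N)$: $\Lambda_{N,k}$ is the $k$-fold anti-symmetric tensor product with inner product $\langle \xi_1\wedge\cdots\wedge\xi_k,\xi_1'\wedge\cdots\wedge\xi_k'\rangle=\det[\langle\xi_i,\xi_j'\rangle]$, and $\Lambda_{N,0}=\mathbb{C}\Omega$ with $\Omega$ a unit vector. The creation operators are $c_{N,j}(\Omega)=e_j$, $c_{N,j}(\xi_1\wedge\cdots\wedge\xi_k)=e_j\wedge\xi_1\wedge\cdots\wedge\xi_k$, and the Fermions are $\omega_j=c_{N,j}+c_{N,j}^*$, $1\leq j\leq N$ (anti-commuting selfadjoint unitaries). $\mathcal{C}_N\subset B(\Lambda_N)$ is the $C^*$-algebra generated by $\omega_1,\dots,\omega_N$ (Clifford algebra). For $n\geq1$, $F_n=\mathrm{Span}\{1,\omega_1,\ldots,\omega_{2n},\omega_1\cdots\omega_{2n}\}\subset\mathcal{C}_{2n}$, and $\tau\colon F_n\to F_n$ is the linear map with $\tau(1)=1$, $\tau(\omega_j)=\omega_j$ for $1\leq j\leq 2n$, and $\tau(\omega_1\cdots\omega_{2n})=-\omega_1\cdots\omega_{2n}$. The completely bounded norm is the usual one: $\|\tau\|_{cb}=\sup_{k\geq1}\|I_{M_k}\otimes\tau\colon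 M_k(F_n)\to M_k(F_n)\|$, where $M_k(F_n)\subset M_k(\mathcal{C}_{2n})$ carries the $C^*$-norm. *)

theory Defs
  imports
    Complex_Main
    "HOL-Library.Extended_Real"
    "HOL-Library.Function_Algebras"
    "HOL-Combinatorics.Permutations"
    "Jordan_Normal_Form.Determinant"
begin

section \<open>The anti-symmetric Fock space\<close>

text \<open>
  A tensor is the family of its coordinates: the value at a list \<open>[i\<^sub>1, \<dots>, i\<^sub>k]\<close> is the
  coefficient of \<open>e\<^bsub>i\<^sub>1\<^esub> \<otimes> \<dots> \<otimes> e\<^bsub>i\<^sub>k\<^esub>\<close>. Tensors of different degrees live in the same type, so that
  sums over degrees are direct sums.
\<close>

type_synonym tensor = "nat list \<Rightarrow> complex"
type_synonym oper = "tensor \<Rightarrow> tensor"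

definition ell2 :: "nat \<Rightarrow> (nat \<Rightarrow> complex) set" where
  "ell2 N = {\<xi>. \<forall>i. i \<notin> {1..N} \<longrightarrow> \<xi> i = 0}"

definition ell2_inner :: "nat \<Rightarrow> (nat \<Rightarrow> complex) \<Rightarrow> (nat \<Rightarrow> complex) \<Rightarrow> complex" where
  "ell2_inner N \<xi> \<eta> = (\<Sum>i=1..N. \<xi> i * cnj (\<eta> i))"

definition basis :: "nat \<Rightarrow> nat \<Rightarrow> complex" where
  "basis j = (\<lambda>i. if i = j then 1 else 0)"

definition antisym_tensors :: "nat \<Rightarrow> nat \<Rightarrow> tensor set" where
  "antisym_tensors N k = {f.
     (\<forall>l. f l \<noteq> 0 \<longrightarrow> length l = k \<and> set l \<subseteq> {1..N}) \<and>
     (\<forall>p l. p permutes {..<length l} \<longrightarrow> f (permute_list p l) = of_int (sign p) * f l)}"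

definition fock :: "nat \<Rightarrow> tensor set" where
  "fock N = {(\<Sum>k\<le>N. g k) | g. \<forall>k\<le>N. g k \<in> antisym_tensors N k}"

text \<open>
  The unnormalised convention \<open>\<xi>\<^sub>1 \<and> \<dots> \<and> \<xi>\<^sub>k = \<Sum>\<^sub>\<sigma> sgn(\<sigma>) \<xi>\<^bsub>\<sigma>(1)\<^esub> \<otimes> \<dots> \<otimes> \<xi>\<^bsub>\<sigma>(k)\<^esub>\<close> is used. The factor
  \<open>1/k!\<close> in the inner product then makes the inner product of two wedges the determinant of
  inner products, see \<open>fock_inner_wedge\<close>. The unit vector \<open>\<Omega>\<close> is \<open>wedge []\<close>.
\<close>

definition wedge :: "(nat \<Rightarrow> complex) list \<Rightarrow> tensor" where
  "wedge \<xi>s = (\<lambda>l. if length l = length \<xi>s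
     then (\<Sum>p | p permutes {..<length l}. of_int (sign p) * (\<Prod>i<length l. (\<xi>s ! p i) (l ! i)))
     else 0)"

definition tuples :: "nat \<Rightarrow> nat list set" where
  "tuples N = {l. set l \<subseteq> {1..N} \<and> length l \<le> N}"

definition fock_inner :: "nat \<Rightarrow> tensor \<Rightarrow> tensor \<Rightarrow> complex" where
  "fock_inner N f g = (\<Sum>l\<in>tuples N. f l * cnj (g l) / fact (length l))"

section \<open>Operators on the Fock space\<close>

definition tscale :: "complex \<Rightarrow> tensor \<Rightarrow> tensor" where
  "tscale c f = (\<lambda>l. c * f l)"

definition oscale :: "complex \<Rightarrow> oper \<Rightarrow> oper" where
  "oscale c T = (\<lambda>f. tscale c (T f))"

text \<open>
  \<open>B(\<Lambda>\<^sub>N)\<close>: since \<open>\<Lambda>\<^sub>N\<close> is finite-dimensional, all linear maps are bounded. Operators are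
  extended by \<open>0\<close> outside \<open>\<Lambda>\<^sub>N\<close>, which makes equality of operators equality of functions.
\<close>

definition fock_ops :: "nat \<Rightarrow> oper set" where
  "fock_ops N = {T.
     (\<forall>f. f \<notin> fock N \<longrightarrow> T f = 0) \<and>
     (\<forall>f\<in>fock N. T f \<in> fock N) \<and>
     (\<forall>f\<in>fock N. \<forall>g\<in>fock N. T (f + g) = T f + T g) \<and>
     (\<forall>c. \<forall>f\<in>fock N. T (tscale c f) = tscale c (T f))}"

definition fock_id :: "nat \<Rightarrow> oper" where
  "fock_id N = (\<lambda>f. if f \<in> fock N then f else 0)"

definition adjoint :: "nat \<Rightarrow> oper \<Rightarrow> oper" where
  "adjoint N T = (THE S. S \<in> fock_ops N \<and>
     (\<forall>f\<in>fock N. \<forall>g\<in>fock N. fock_inner N (T f) g = fock_inner N f (S g)))"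

text \<open>
  Exterior multiplication of a tensor by \<open>e\<^sub>j\<close>, in coordinates. It is characterised by its values
  on wedges in \<open>creation_wedge\<close> and \<open>creation_unique\<close>.
\<close>

definition creation :: "nat \<Rightarrow> nat \<Rightarrow> oper" where
  "creation N j = (\<lambda>f. if f \<in> fock N
     then (\<lambda>l. \<Sum>m<length l. (-1) ^ m * basis j (l ! m) * f (take m l @ drop (Suc m) l))
     else 0)"

definition fermion :: "nat \<Rightarrow> nat \<Rightarrow> oper" where
  "fermion N j = creation N j + adjoint N (creation N j)"

section \<open>The Clifford algebra, the space \<open>F\<^sub>n\<close> and completely bounded norms\<close>

text \<open>
  A \<open>k \<times> k\<close> matrix of operators is a function of two indices below \<open>k\<close>. Its norm is the operator
  norm on the \<open>k\<close>-fold direct sum of \<open>\<Lambda>\<^sub>N\<close>, that is, the \<open>C\<^sup>*\<close>-norm of \<open>M\<^sub>k(B(\<Lambda>\<^sub>N))\<close> and of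
  each of its \<open>C\<^sup>*\<close>-subalgebras, in particular of \<open>M\<^sub>k(clifford N)\<close>. Suprema are taken in
  the extended reals, where they always exist.
\<close>

definition column_norm :: "nat \<Rightarrow> nat \<Rightarrow> (nat \<Rightarrow> tensor) \<Rightarrow> real" where
  "column_norm N k x = sqrt (\<Sum>i<k. Re (fock_inner N (x i) (x i)))"

definition mat_norm :: "nat \<Rightarrow> nat \<Rightarrow> (nat \<Rightarrow> nat \<Rightarrow> oper) \<Rightarrow> ereal" where
  "mat_norm N k a = (SUP x\<in>{x. (\<forall>j<k. x j \<in> fock N) \<and> column_norm N k x \<le> 1}.
     ereal (column_norm N k (\<lambda>i. \<Sum>j<k. a i j (x j))))"

definition cstar_subalgebra :: "nat \<Rightarrow> oper set \<Rightarrow> bool" where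
  "cstar_subalgebra N A \<longleftrightarrow> A \<subseteq> fock_ops N \<and> 0 \<in> A \<and>
     (\<forall>S\<in>A. \<forall>T\<in>A. S + T \<in> A \<and> S \<circ> T \<in> A) \<and>
     (\<forall>T\<in>A. adjoint N T \<in> A \<and> (\<forall>c. oscale c T \<in> A)) \<and>
     (\<forall>T\<in>fock_ops N. (\<forall>\<epsilon>>0. \<exists>S\<in>A. mat_norm N 1 (\<lambda>_ _. T - S) < ereal \<epsilon>) \<longrightarrow> T \<in> A)"

definition clifford :: "nat \<Rightarrow> oper set" where
  "clifford N = \<Inter>{A. cstar_subalgebra N A \<and> fermion N ` {1..N} \<subseteq> A}"

definition fermion_prod :: "nat \<Rightarrow> oper" where
  "fermion_prod N = foldr (\<circ>) (map (fermion N) [1..<Suc N]) (fock_id N)"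

global_interpretation operators: vector_space oscale
  by unfold_locales (auto simp: oscale_def tscale_def fun_eq_iff algebra_simps)

definition F_space :: "nat \<Rightarrow> oper set" where
  "F_space n = operators.span
     ({fock_id (2 * n)} \<union> fermion (2 * n) ` {1..2 * n} \<union> {fermion_prod (2 * n)})"

definition linear_map_on :: "oper set \<Rightarrow> oper set \<Rightarrow> (oper \<Rightarrow> oper) \<Rightarrow> bool" where
  "linear_map_on V W \<phi> \<longleftrightarrow> (\<forall>T\<in>V. \<phi> T \<in> W) \<and>
     (\<forall>S\<in>V. \<forall>T\<in>V. \<phi> (S + T) = \<phi> S + \<phi> T) \<and> (\<forall>c. \<forall>T\<in>V. \<phi> (oscale c T) = oscale c (\<phi> T))"

definition mats :: "nat \<Rightarrow> oper set \<Rightarrow> (nat \<Rightarrow> nat \<Rightarrow> oper) set" where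
  "mats k V = {a. \<forall>i<k. \<forall>j<k. a i j \<in> V}"

definition amplification_norm :: "nat \<Rightarrow> oper set \<Rightarrow> (oper \<Rightarrow> oper) \<Rightarrow> nat \<Rightarrow> ereal" where
  "amplification_norm N V \<phi> k =
     (SUP a\<in>{a \<in> mats k V. mat_norm N k a \<le> 1}. mat_norm N k (\<lambda>i j. \<phi> (a i j)))"

definition cb_norm :: "nat \<Rightarrow> oper set \<Rightarrow> (oper \<Rightarrow> oper) \<Rightarrow> ereal" where
  "cb_norm N V \<phi> = (SUP k\<in>{1..}. amplification_norm N V \<phi> k)"

section \<open>The definitions agree with their characterisations\<close>

text \<open>
  Wedges span \<open>\<Lambda>\<^sub>N\<close> (\<open>fock_expand\<close>) and have the determinant as inner product (\<open>fock_inner_wedge\<close>);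
  adjoints exist and are unique (\<open>adjoint_exists\<close>); the creation operators are the only operators
  with the prescribed values on wedges (\<open>creation_wedge\<close>, \<open>creation_unique\<close>); the fermions are
  anti-commuting selfadjoint unitaries (\<open>adjoint_fermion\<close>, \<open>fermion_anticommute\<close>); \<open>F\<^sub>n\<close> lies in
  the Clifford algebra (\<open>F_space_subset_clifford\<close>); and the map prescribed on the generators of \<open>F\<^sub>n\<close> exists (\<open>flip_exists\<close>).
\<close>

lemma tensor_sum_apply: "(\<Sum>x\<in>A. h x) (l :: 'b) = (\<Sum>x\<in>A. (h x l :: complex))"
  by (induction A rule: infinite_finite_induct) auto

lemma finite_tuples [simp]: "finite (tuples N)"
  unfolding tuples_def by (rule finite_lists_length_le) simp

lemma antisym_repeated:
  assumes f: "f \<in> antisym_tensors N k" and ij: "i < length l" "j < length l" "i \<noteq> j" "l ! i = l ! j"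
  shows "f l = 0"
proof -
  have p: "transpose i j permutes {..<length l}"
    using ij by (intro permutes_swap_id) auto
  have "permute_list (transpose i j) l = l"
    using ij p by (intro nth_equalityI) (auto simp: permute_list_nth transpose_def)
  moreover have "f (permute_list (transpose i j) l) = of_int (sign (transpose i j)) * f l"
    using f p unfolding antisym_tensors_def by blast
  ultimately show ?thesis using ij by (simp add: sign_swap_id)
qed

lemma antisym_not_distinct:
  assumes "f \<in> antisym_tensors N k" "\<not> distinct l" shows "f l = 0"
  using assms antisym_repeated unfolding distinct_conv_nth by blast

lemma antisym_high_degree:
  assumes f: "f \<in> antisym_tensors N k" and k: "N < k" shows "f = 0"
proof
  fix l
  show "f l = 0 l"
  proof (rule ccontr)
    assume "f l \<noteq> 0 l"
    then have nz: "f l \<noteq> 0" by simp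
    then have l: "length l = k" "set l \<subseteq> {1..N}" using f unfolding antisym_tensors_def by blast+
    have "distinct l" using nz antisym_not_distinct[OF f] by blast
    then have "k = card (set l)" using l distinct_card by metis
    also have "\<dots> \<le> N" using card_mono[OF _ l(2)] by simp
    finally show False using k by simp
  qed
qed

lemma fock_iff:
  "f \<in> fock N \<longleftrightarrow> (\<forall>l. f l \<noteq> 0 \<longrightarrow> l \<in> tuples N) \<and>
     (\<forall>p l. p permutes {..<length l} \<longrightarrow> f (permute_list p l) = of_int (sign p) * f l)"
    (is "_ \<longleftrightarrow> ?R f")
proof
  assume "f \<in> fock N"
  then obtain g where f: "f = (\<Sum>k\<le>N. g k)" and g: "\<And>k. k \<le> N \<Longrightarrow> g k \<in> antisym_tensors N k"
    unfolding fock_def by auto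
  have "l \<in> tuples N" if nz: "f l \<noteq> 0" for l
  proof -
    obtain k where "k \<le> N" "g k l \<noteq> 0"
      using nz unfolding f tensor_sum_apply by (meson atMost_iff sum.neutral)
    then show ?thesis using g[of k] unfolding antisym_tensors_def tuples_def by auto
  qed
  moreover have "f (permute_list p l) = of_int (sign p) * f l" if p: "p permutes {..<length l}" for p l
  proof -
    have "g k (permute_list p l) = of_int (sign p) * g k l" if "k \<le> N" for k
      using g[OF that] p unfolding antisym_tensors_def by blast
    then show ?thesis unfolding f tensor_sum_apply sum_distrib_left by (intro sum.cong) auto
  qed
  ultimately show "?R f" by blast
next
  assume R: "?R f"
  define g where "g k = (\<lambda>l. if length l = k then f l else 0)" for k :: nat
  have "g k \<in> antisym_tensors N k" for k
    using R unfolding antisym_tensors_def g_def tuples_def by auto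
  moreover have "f = (\<Sum>k\<le>N. g k)"
  proof
    fix l
    have "f l = 0" if "\<not> length l \<le> N" using R that unfolding tuples_def by auto
    then show "f l = (\<Sum>k\<le>N. g k) l" unfolding tensor_sum_apply g_def by auto
  qed
  ultimately show "f \<in> fock N" unfolding fock_def by blast
qed

lemma fock_antisym: "f \<in> fock N \<Longrightarrow> p permutes {..<length l} \<Longrightarrow> f (permute_list p l) = of_int (sign p) * f l"
  unfolding fock_iff by blast

lemma fock_support: "f \<in> fock N \<Longrightarrow> l \<notin> tuples N \<Longrightarrow> f l = 0"
  unfolding fock_iff by blast

lemma fock_zero [simp]: "0 \<in> fock N"
  by (simp add: fock_iff)

lemma fock_add [intro]: "f \<in> fock N \<Longrightarrow> g \<in> fock N \<Longrightarrow> f + g \<in> fock N"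
  unfolding fock_iff by (auto simp: algebra_simps) (metis add_0)

lemma fock_tscale [intro]: "f \<in> fock N \<Longrightarrow> tscale c f \<in> fock N"
  unfolding fock_iff tscale_def by auto

lemma fock_sum: "(\<And>x. x \<in> A \<Longrightarrow> h x \<in> fock N) \<Longrightarrow> (\<Sum>x\<in>A. h x) \<in> fock N"
  by (induction A rule: infinite_finite_induct) auto

lemma antisym_subset_fock: "antisym_tensors N k \<subseteq> fock N"
proof
  fix f assume f: "f \<in> antisym_tensors N k"
  show "f \<in> fock N"
  proof (cases "k \<le> N")
    case True
    then show ?thesis using f unfolding fock_iff antisym_tensors_def tuples_def by auto
  next
    case False
    then show ?thesis using antisym_high_degree[OF f] by simp
  qed
qed

lemma wedge_det:
  assumes "length l = length \<xi>s"
  shows "wedge \<xi>s l = det (mat (length l) (length l) (\<lambda>(i, j). (\<xi>s ! i) (l ! j)))"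
proof -
  let ?k = "length l"
  let ?A = "mat ?k ?k (\<lambda>(i, j). (\<xi>s ! j) (l ! i))"
  have "wedge \<xi>s l = det ?A"
  proof -
    have "wedge \<xi>s l = (\<Sum>p | p permutes {0..<?k}. of_int (sign p) * (\<Prod>i = 0..<?k. (\<xi>s ! p i) (l ! i)))"
      using assms by (simp add: wedge_def lessThan_atLeast0)
    also have "\<dots> = (\<Sum>p | p permutes {0..<?k}. of_int (sign p) * (\<Prod>i = 0..<?k. ?A $$ (i, p i)))"
    proof (intro sum.cong refl arg_cong2[where f = "(*)"] prod.cong)
      fix p i assume "p \<in> {p. p permutes {0..<?k}}" "i \<in> {0..<?k}"
      then have "p i < ?k" "i < ?k" using permutes_in_image[of p "{0..<?k}" i] by auto
      then show "(\<xi>s ! p i) (l ! i) = ?A $$ (i, p i)" by simp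
    qed
    finally show ?thesis by (simp add: det_def)
  qed
  also have "?A = (mat ?k ?k (\<lambda>(i, j). (\<xi>s ! i) (l ! j)))\<^sup>T"
    by (intro eq_matI) auto
  also have "det \<dots> = det (mat ?k ?k (\<lambda>(i, j). (\<xi>s ! i) (l ! j)))"
    by (intro det_transpose) auto
  finally show ?thesis .
qed

lemma wedge_antisym:
  assumes q: "q permutes {..<length l}"
  shows "wedge \<xi>s (permute_list q l) = of_int (sign q) * wedge \<xi>s l"
proof (cases "length l = length \<xi>s")
  case False
  then show ?thesis by (simp add: wedge_def)
next
  case True
  let ?k = "length l"
  let ?A = "mat ?k ?k (\<lambda>(i, j). (\<xi>s ! j) (l ! i))"
  have T: "det (mat ?k ?k (\<lambda>(i, j). (\<xi>s ! i) (m ! j))) = det (mat ?k ?k (\<lambda>(i, j). (\<xi>s ! j) (m ! i)))" for m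
  proof -
    have "mat ?k ?k (\<lambda>(i, j). (\<xi>s ! j) (m ! i)) = (mat ?k ?k (\<lambda>(i, j). (\<xi>s ! i) (m ! j)))\<^sup>T"
      by (intro eq_matI) auto
    then show ?thesis by (simp add: det_transpose[where n = ?k])
  qed
  have q': "q permutes {0..<?k}" using q by (simp add: lessThan_atLeast0)
  have qi: "q i < ?k" if "i < ?k" for i using permutes_in_image[OF q, of i] that by simp
  have "wedge \<xi>s (permute_list q l) = det (mat ?k ?k (\<lambda>(i, j). (\<xi>s ! j) (permute_list q l ! i)))"
    using True T[of "permute_list q l"] by (simp add: wedge_det)
  also have "mat ?k ?k (\<lambda>(i, j). (\<xi>s ! j) (permute_list q l ! i)) = mat ?k ?k (\<lambda>(i, j). ?A $$ (q i, j))"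
    using qi by (intro eq_matI) (auto simp: permute_list_nth[OF q])
  also have "det \<dots> = of_int (sign q) * det ?A"
    by (rule det_permute_rows[OF _ q']) simp
  also have "det ?A = wedge \<xi>s l" using True T[of l] by (simp add: wedge_det)
  finally show ?thesis .
qed

lemma wedge_in_antisym_tensors:
  assumes "set \<xi>s \<subseteq> ell2 N"
  shows "wedge \<xi>s \<in> antisym_tensors N (length \<xi>s)"
proof -
  have "length l = length \<xi>s \<and> set l \<subseteq> {1..N}" if nz: "wedge \<xi>s l \<noteq> 0" for l
  proof -
    have len: "length l = length \<xi>s" using nz unfolding wedge_def by metis
    have "(\<Sum>p | p permutes {..<length l}. of_int (sign p) * (\<Prod>i<length l. (\<xi>s ! p i) (l ! i))) \<noteq> 0"
      using nz len by (simp add: wedge_def)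
    then obtain p where p: "p permutes {..<length l}" "(\<Prod>i<length l. (\<xi>s ! p i) (l ! i)) \<noteq> 0"
      by (metis (mono_tags, lifting) mem_Collect_eq mult_zero_right sum.neutral)
    have "l ! i \<in> {1..N}" if i: "i < length l" for i
    proof -
      have "(\<xi>s ! p i) (l ! i) \<noteq> 0" using p(2) i by simp
      moreover have "p i < length \<xi>s" using permutes_in_image[OF p(1), of i] i len by simp
      ultimately show ?thesis using assms nth_mem unfolding ell2_def by blast
    qed
    then show ?thesis using len by (auto simp: in_set_conv_nth)
  qed
  then show ?thesis using wedge_antisym unfolding antisym_tensors_def by blast
qed

lemma wedge_in_fock: "set \<xi>s \<subseteq> ell2 N \<Longrightarrow> wedge \<xi>s \<in> fock N"
  using wedge_in_antisym_tensors antisym_subset_fock by blast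

lemma basis_in_ell2: "j \<in> {1..N} \<Longrightarrow> basis j \<in> ell2 N"
  by (auto simp: ell2_def basis_def)

lemma wedge_basis_in_fock: "l \<in> tuples N \<Longrightarrow> wedge (map basis l) \<in> fock N"
  by (rule wedge_in_fock) (auto simp: tuples_def intro!: basis_in_ell2)

lemma wedge_basis:
  "wedge (map basis l) l' =
     (\<Sum>p | p permutes {..<length l}. if l' = permute_list p l then of_int (sign p) else 0)"
proof (cases "length l' = length l")
  case False
  then have "l' \<noteq> permute_list p l" for p by (metis length_permute_list)
  then show ?thesis using False by (simp add: wedge_def)
next
  case True
  have "of_int (sign p) * (\<Prod>i<length l'. (map basis l ! p i) (l' ! i))
      = (if l' = permute_list p l then of_int (sign p) else (0::complex))"
    if p: "p permutes {..<length l}" for p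
  proof (cases "l' = permute_list p l")
    case T: True
    have "(map basis l ! p i) (l' ! i) = 1" if "i < length l" for i
      using that permutes_in_image[OF p, of i] by (simp add: T permute_list_nth[OF p] basis_def)
    then show ?thesis using T True by simp
  next
    case F: False
    then obtain i where i: "i < length l" "l' ! i \<noteq> l ! p i"
      using True by (metis length_permute_list nth_equalityI permute_list_nth[OF p])
    then have "(map basis l ! p i) (l' ! i) = 0"
      using permutes_in_image[OF p, of i] by (simp add: basis_def)
    then have "(\<Prod>i<length l'. (map basis l ! p i) (l' ! i)) = 0"
      using i True by (intro prod_zero) auto
    then show ?thesis using F by simp
  qed
  then show ?thesis using True by (simp add: wedge_def)
qed

lemma wedge_basis_sym: "wedge (map basis l) l' = wedge (map basis l') l"
proof (cases "length l = length l'")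
  case True
  let ?k = "length l"
  let ?A = "mat ?k ?k (\<lambda>(i, j). (map basis l ! i) (l' ! j))"
  have "wedge (map basis l') l = det ?A\<^sup>T"
    using True by (subst wedge_det) (auto intro!: arg_cong[where f = det] eq_matI simp: basis_def)
  then show ?thesis using True by (simp add: wedge_det det_transpose[where n = ?k])
qed (simp add: wedge_def)

lemma cnj_wedge_basis: "cnj (wedge (map basis l) l') = wedge (map basis l) l'"
  unfolding wedge_basis by (simp add: if_distrib cong: if_cong)

lemma fock_inner_wedge_basis:
  assumes f: "f \<in> fock N" and l: "l \<in> tuples N"
  shows "fock_inner N f (wedge (map basis l)) = f l"
proof -
  let ?P = "{p. p permutes {..<length l}}"
  have fin: "finite ?P" by (simp add: finite_permutations)
  have tup: "permute_list p l \<in> tuples N" if "p \<in> ?P" for p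
    using l that by (simp add: tuples_def)
  have "fock_inner N f (wedge (map basis l))
      = (\<Sum>l'\<in>tuples N. \<Sum>p\<in>?P. if l' = permute_list p l then f l' * of_int (sign p) / fact (length l') else 0)"
    unfolding fock_inner_def cnj_wedge_basis unfolding wedge_basis
    unfolding sum_distrib_left sum_divide_distrib by (intro sum.cong refl) simp
  also have "\<dots> = (\<Sum>p\<in>?P. \<Sum>l'\<in>tuples N. if l' = permute_list p l then f l' * of_int (sign p) / fact (length l') else 0)"
    by (rule sum.swap)
  also have "\<dots> = (\<Sum>p\<in>?P. f l / fact (length l))"
  proof (intro sum.cong refl)
    fix p assume p: "p \<in> ?P"
    have "(\<Sum>l'\<in>tuples N. if l' = permute_list p l then f l' * of_int (sign p) / fact (length l') else 0)
       = f (permute_list p l) * of_int (sign p) / fact (length l)"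
      using tup[OF p] by simp
    also have "\<dots> = f l / fact (length l)"
      using fock_antisym[OF f, of p l] p by (simp add: sign_def)
    finally show "(\<Sum>l'\<in>tuples N. if l' = permute_list p l then f l' * of_int (sign p) / fact (length l') else 0)
       = f l / fact (length l)" .
  qed
  also have "\<dots> = f l" by (simp add: card_permutations[OF refl])
  finally show ?thesis .
qed

lemma fock_expand:
  assumes f: "f \<in> fock N"
  shows "f = (\<Sum>l\<in>tuples N. tscale (f l / fact (length l)) (wedge (map basis l)))"
proof
  fix l0
  show "f l0 = (\<Sum>l\<in>tuples N. tscale (f l / fact (length l)) (wedge (map basis l))) l0"
  proof (cases "l0 \<in> tuples N")
    case True
    have "f l0 = fock_inner N f (wedge (map basis l0))" using fock_inner_wedge_basis[OF f True] by simp
    also have "\<dots> = (\<Sum>l\<in>tuples N. tscale (f l / fact (length l)) (wedge (map basis l))) l0"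
      unfolding fock_inner_def cnj_wedge_basis tensor_sum_apply tscale_def
      by (intro sum.cong refl) (simp add: wedge_basis_sym[of l0])
    finally show ?thesis .
  next
    case False
    have "wedge (map basis l) l0 = 0" if "l \<in> tuples N" for l
      using fock_support[OF wedge_basis_in_fock[OF that] False] .
    then show ?thesis using fock_support[OF f False] unfolding tensor_sum_apply tscale_def by simp
  qed
qed


lemma fock_inner_add_left: "fock_inner N (f + g) h = fock_inner N f h + fock_inner N g h"
  unfolding fock_inner_def sum.distrib[symmetric] by (intro sum.cong refl) (simp add: add_divide_distrib algebra_simps)

lemma fock_inner_tscale_left: "fock_inner N (tscale c f) h = c * fock_inner N f h"
  unfolding fock_inner_def tscale_def sum_distrib_left by (intro sum.cong refl) simp

lemma fock_inner_zero [simp]: "fock_inner N 0 h = 0" "fock_inner N h 0 = 0"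
  unfolding fock_inner_def by auto

lemma fock_inner_sum_left: "fock_inner N (\<Sum>x\<in>A. h x) g = (\<Sum>x\<in>A. fock_inner N (h x) g)"
proof -
  have "fock_inner N (\<Sum>x\<in>A. h x) g = (\<Sum>l\<in>tuples N. \<Sum>x\<in>A. h x l * cnj (g l) / fact (length l))"
    unfolding fock_inner_def tensor_sum_apply sum_distrib_right sum_divide_distrib ..
  also have "\<dots> = (\<Sum>x\<in>A. fock_inner N (h x) g)"
    unfolding fock_inner_def by (rule sum.swap)
  finally show ?thesis .
qed

lemma fock_inner_cnj: "cnj (fock_inner N f g) = fock_inner N g f"
  unfolding fock_inner_def by (simp add: mult.commute)

lemma fock_inner_eqI:
  assumes "f \<in> fock N" "g \<in> fock N" "\<And>h. h \<in> fock N \<Longrightarrow> fock_inner N f h = fock_inner N g h"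
  shows "f = g"
proof
  fix l show "f l = g l"
  proof (cases "l \<in> tuples N")
    case True
    then show ?thesis
      using fock_inner_wedge_basis[of f N l] fock_inner_wedge_basis[of g N l] assms wedge_basis_in_fock by metis
  qed (use assms in \<open>simp add: fock_support\<close>)
qed

lemma fock_ops_in: "T \<in> fock_ops N \<Longrightarrow> T f \<in> fock N"
  unfolding fock_ops_def by (cases "f \<in> fock N") auto

lemma fock_ops_add: "T \<in> fock_ops N \<Longrightarrow> f \<in> fock N \<Longrightarrow> g \<in> fock N \<Longrightarrow> T (f + g) = T f + T g"
  unfolding fock_ops_def by blast

lemma fock_ops_tscale: "T \<in> fock_ops N \<Longrightarrow> f \<in> fock N \<Longrightarrow> T (tscale c f) = tscale c (T f)"
  unfolding fock_ops_def by blast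

lemma fock_ops_outside: "T \<in> fock_ops N \<Longrightarrow> f \<notin> fock N \<Longrightarrow> T f = 0"
  unfolding fock_ops_def by blast

lemma fock_ops_zero: "T \<in> fock_ops N \<Longrightarrow> T 0 = 0"
  using fock_ops_add[of T N 0 0] by simp

lemma fock_ops_sum:
  assumes T: "T \<in> fock_ops N" and h: "\<And>x. x \<in> A \<Longrightarrow> h x \<in> fock N"
  shows "T (\<Sum>x\<in>A. h x) = (\<Sum>x\<in>A. T (h x))"
  using h by (induction A rule: infinite_finite_induct)
    (simp_all add: fock_ops_zero[OF T] fock_ops_add[OF T] fock_sum)

lemma fock_ops_expand:
  assumes T: "T \<in> fock_ops N" and f: "f \<in> fock N"
  shows "T f = (\<Sum>l\<in>tuples N. tscale (f l / fact (length l)) (T (wedge (map basis l))))"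
proof -
  have "T f = T (\<Sum>l\<in>tuples N. tscale (f l / fact (length l)) (wedge (map basis l)))"
    using fock_expand[OF f] by simp
  also have "\<dots> = (\<Sum>l\<in>tuples N. T (tscale (f l / fact (length l)) (wedge (map basis l))))"
    by (intro fock_ops_sum[OF T] fock_tscale wedge_basis_in_fock)
  also have "\<dots> = (\<Sum>l\<in>tuples N. tscale (f l / fact (length l)) (T (wedge (map basis l))))"
    by (intro sum.cong refl fock_ops_tscale[OF T] wedge_basis_in_fock)
  finally show ?thesis .
qed

lemma fock_ops_eqI:
  assumes "S \<in> fock_ops N" "T \<in> fock_ops N" "\<And>f. f \<in> fock N \<Longrightarrow> S f = T f"
  shows "S = T"
  using assms fock_ops_outside by (intro ext) metis

lemma adjoint_exists:
  assumes T: "T \<in> fock_ops N"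
  shows "\<exists>!S. S \<in> fock_ops N \<and>
     (\<forall>f\<in>fock N. \<forall>g\<in>fock N. fock_inner N (T f) g = fock_inner N f (S g))"
proof (rule ex_ex1I)
  define S where "S g = (if g \<in> fock N
    then (\<lambda>l. if l \<in> tuples N then fock_inner N g (T (wedge (map basis l))) else 0) else 0)" for g
  have "S g \<in> fock N" if g: "g \<in> fock N" for g
  proof -
    have "S g (permute_list p l) = of_int (sign p) * S g l" if p: "p permutes {..<length l}" for p l
    proof -
      have tup: "permute_list p l \<in> tuples N \<longleftrightarrow> l \<in> tuples N"
        using p by (simp add: tuples_def)
      have w: "wedge (map basis (permute_list p l)) = tscale (of_int (sign p)) (wedge (map basis l))"
        by (rule ext) (metis p tscale_def wedge_antisym wedge_basis_sym)
      show ?thesis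
      proof (cases "l \<in> tuples N")
        case True
        have "fock_inner N g (T (wedge (map basis (permute_list p l))))
            = cnj (fock_inner N (tscale (of_int (sign p)) (T (wedge (map basis l)))) g)"
          by (simp add: w fock_inner_cnj fock_ops_tscale[OF T wedge_basis_in_fock[OF True]])
        also have "\<dots> = of_int (sign p) * fock_inner N g (T (wedge (map basis l)))"
          by (simp add: fock_inner_tscale_left fock_inner_cnj)
        finally show ?thesis using g tup True by (simp add: S_def)
      qed (simp add: S_def tup)
    qed
    then show ?thesis unfolding fock_iff by (auto simp: S_def split: if_splits)
  qed
  moreover have "S (f + g) = S f + S g" if "f \<in> fock N" "g \<in> fock N" for f g
    using that by (auto simp: S_def fock_add fock_inner_add_left)
  moreover have "S (tscale c f) = tscale c (S f)" if "f \<in> fock N" for c f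
    using that by (intro ext) (simp add: S_def fock_tscale fock_inner_tscale_left, simp add: tscale_def)
  moreover have "S f = 0" if "f \<notin> fock N" for f using that by (simp add: S_def)
  ultimately have "S \<in> fock_ops N" unfolding fock_ops_def by blast
  moreover have "fock_inner N (T f) g = fock_inner N f (S g)" if f: "f \<in> fock N" and g: "g \<in> fock N" for f g
  proof -
    have "fock_inner N (T f) g = (\<Sum>l\<in>tuples N. f l / fact (length l) * fock_inner N (T (wedge (map basis l))) g)"
      unfolding fock_ops_expand[OF T f] fock_inner_sum_left fock_inner_tscale_left ..
    also have "\<dots> = fock_inner N f (S g)"
      unfolding fock_inner_def[of N f] by (intro sum.cong refl) (simp add: S_def g fock_inner_cnj)
    finally show ?thesis .
  qed
  ultimately show "\<exists>S. S \<in> fock_ops N \<and>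
     (\<forall>f\<in>fock N. \<forall>g\<in>fock N. fock_inner N (T f) g = fock_inner N f (S g))" by blast
next
  fix S S'
  assume S: "S \<in> fock_ops N \<and> (\<forall>f\<in>fock N. \<forall>g\<in>fock N. fock_inner N (T f) g = fock_inner N f (S g))"
    and S': "S' \<in> fock_ops N \<and> (\<forall>f\<in>fock N. \<forall>g\<in>fock N. fock_inner N (T f) g = fock_inner N f (S' g))"
  have "S g = S' g" if g: "g \<in> fock N" for g
  proof (rule fock_inner_eqI[of _ N])
    show "S g \<in> fock N" "S' g \<in> fock N" using S S' fock_ops_in by auto
    fix h assume h: "h \<in> fock N"
    have "fock_inner N h (S g) = fock_inner N h (S' g)" using S S' g h by metis
    then show "fock_inner N (S g) h = fock_inner N (S' g) h" by (metis fock_inner_cnj)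
  qed
  then show "S = S'" using S S' fock_ops_eqI by blast
qed

lemma adjoint_fock_ops: "T \<in> fock_ops N \<Longrightarrow> adjoint N T \<in> fock_ops N"
  unfolding adjoint_def using theI'[OF adjoint_exists] by blast

lemma adjoint_inner:
  "T \<in> fock_ops N \<Longrightarrow> f \<in> fock N \<Longrightarrow> g \<in> fock N \<Longrightarrow>
     fock_inner N (T f) g = fock_inner N f (adjoint N T g)"
  unfolding adjoint_def using theI'[OF adjoint_exists] by blast

lemma creation_wedge_aux:
  "(\<Sum>m<length l. (-1) ^ m * \<xi> (l ! m) * wedge \<xi>s (take m l @ drop (Suc m) l)) = wedge (\<xi> # \<xi>s) l"
proof (cases "length l = Suc (length \<xi>s)")
  case False
  have "wedge \<xi>s (take m l @ drop (Suc m) l) = 0" if "m < length l" for m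
    using that False by (auto simp: wedge_def)
  then show ?thesis using False by (simp add: wedge_def)
next
  case True
  let ?k = "length \<xi>s"
  let ?A = "mat (Suc ?k) (Suc ?k) (\<lambda>(i, j). ((\<xi> # \<xi>s) ! i) (l ! j))"
  have "wedge (\<xi> # \<xi>s) l = det ?A" using True by (simp add: wedge_det)
  also have "\<dots> = (\<Sum>m<Suc ?k. ?A $$ (0, m) * cofactor ?A 0 m)"
    by (rule laplace_expansion_row) auto
  also have "\<dots> = (\<Sum>m<length l. (-1) ^ m * \<xi> (l ! m) * wedge \<xi>s (take m l @ drop (Suc m) l))"
    unfolding True
  proof (intro sum.cong refl)
    fix m assume m: "m \<in> {..<Suc ?k}"
    let ?l = "take m l @ drop (Suc m) l"
    have len: "length ?l = ?k" using m True by auto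
    have "mat_delete ?A 0 m = mat ?k ?k (\<lambda>(i, j). (\<xi>s ! i) (?l ! j))"
      using m True by (intro eq_matI) (auto simp: mat_delete_def nth_append)
    then have "det (mat_delete ?A 0 m) = wedge \<xi>s ?l" using len by (simp add: wedge_det)
    then show "?A $$ (0, m) * cofactor ?A 0 m = (-1) ^ m * \<xi> (l ! m) * wedge \<xi>s ?l"
      using m by (simp add: cofactor_def)
  qed
  finally show ?thesis by simp
qed

theorem creation_wedge:
  assumes "set \<xi>s \<subseteq> ell2 N"
  shows "creation N j (wedge \<xi>s) = wedge (basis j # \<xi>s)"
  using wedge_in_fock[OF assms] by (simp add: creation_def creation_wedge_aux)

lemma creation_add:
  "f \<in> fock N \<Longrightarrow> g \<in> fock N \<Longrightarrow> creation N j (f + g) = creation N j f + creation N j g"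
  by (auto simp: creation_def fock_add sum.distrib[symmetric] algebra_simps)

lemma creation_tscale:
  "f \<in> fock N \<Longrightarrow> creation N j (tscale c f) = tscale c (creation N j f)"
  by (simp add: creation_def fock_tscale) (simp add: tscale_def sum_distrib_left algebra_simps)

lemma creation_fock_ops:
  assumes j: "j \<in> {1..N}"
  shows "creation N j \<in> fock_ops N"
proof -
  have zero: "creation N j 0 = 0" by (auto simp: creation_def)
  have sum: "creation N j (\<Sum>x\<in>A. h x) = (\<Sum>x\<in>A. creation N j (h x))"
    if "\<And>x. x \<in> A \<Longrightarrow> h x \<in> fock N" for A and h :: "nat list \<Rightarrow> tensor"
    using that by (induction A rule: infinite_finite_induct) (simp_all add: zero creation_add fock_sum)
  have "creation N j f \<in> fock N" if f: "f \<in> fock N" for f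
  proof -
    have "creation N j f = creation N j (\<Sum>l\<in>tuples N. tscale (f l / fact (length l)) (wedge (map basis l)))"
      using fock_expand[OF f] by simp
    also have "\<dots> = (\<Sum>l\<in>tuples N. creation N j (tscale (f l / fact (length l)) (wedge (map basis l))))"
      by (intro sum fock_tscale wedge_basis_in_fock)
    also have "\<dots> \<in> fock N"
    proof (intro fock_sum)
      fix l assume l: "l \<in> tuples N"
      then have "set (map basis l) \<subseteq> ell2 N" by (auto simp: tuples_def intro!: basis_in_ell2)
      then show "creation N j (tscale (f l / fact (length l)) (wedge (map basis l))) \<in> fock N"
        using j wedge_in_fock[of "basis j # map basis l" N] basis_in_ell2[OF j]
        by (simp add: creation_tscale wedge_basis_in_fock[OF l] creation_wedge fock_tscale)
    qed
    finally show ?thesis .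
  qed
  moreover have "creation N j f = 0" if "f \<notin> fock N" for f using that by (simp add: creation_def)
  ultimately show ?thesis by (simp add: fock_ops_def creation_add creation_tscale)
qed

theorem creation_unique:
  assumes j: "j \<in> {1..N}" and T: "T \<in> fock_ops N"
    and w: "\<And>\<xi>s. set \<xi>s \<subseteq> ell2 N \<Longrightarrow> T (wedge \<xi>s) = wedge (basis j # \<xi>s)"
  shows "T = creation N j"
proof (rule fock_ops_eqI[OF T creation_fock_ops[OF j]])
  fix f assume f: "f \<in> fock N"
  have "set (map basis l) \<subseteq> ell2 N" if "l \<in> tuples N" for l
    using that by (auto simp: tuples_def intro!: basis_in_ell2)
  then show "T f = creation N j f"
    unfolding fock_ops_expand[OF T f] fock_ops_expand[OF creation_fock_ops[OF j] f]
    by (intro sum.cong refl) (simp add: w creation_wedge)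
qed

lemma adjoint_creation:
  assumes j: "j \<in> {1..N}" and f: "f \<in> fock N"
  shows "adjoint N (creation N j) f = (\<lambda>l. f (j # l))"
proof
  fix l
  let ?c = "creation N j"
  have a: "adjoint N ?c f \<in> fock N" using fock_ops_in[OF adjoint_fock_ops[OF creation_fock_ops[OF j]]] .
  show "adjoint N ?c f l = f (j # l)"
  proof (cases "l \<in> tuples N")
    case False
    then have "j # l \<notin> tuples N" by (auto simp: tuples_def)
    then show ?thesis using fock_support[OF a False] fock_support[OF f] by simp
  next
    case True
    have set: "set (map basis l) \<subseteq> ell2 N" using True by (auto simp: tuples_def intro!: basis_in_ell2)
    have "adjoint N ?c f l = cnj (fock_inner N (wedge (map basis l)) (adjoint N ?c f))"
      by (simp add: fock_inner_wedge_basis[OF a True] fock_inner_cnj)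
    also have "\<dots> = fock_inner N f (wedge (map basis (j # l)))"
      by (simp add: adjoint_inner[OF creation_fock_ops[OF j] wedge_basis_in_fock[OF True] f, symmetric]
          creation_wedge[OF set] fock_inner_cnj)
    also have "\<dots> = f (j # l)"
    proof (cases "j # l \<in> tuples N")
      case False
      then have len: "N < length (map basis (j # l))" using j True by (auto simp: tuples_def)
      have "set (map basis (j # l)) \<subseteq> ell2 N" using set basis_in_ell2[OF j] by simp
      then have "wedge (map basis (j # l)) = 0"
        using antisym_high_degree[OF wedge_in_antisym_tensors len] by blast
      then show ?thesis using fock_support[OF f False] by simp
    qed (rule fock_inner_wedge_basis[OF f])
    finally show ?thesis .
  qed
qed

lemma sum_lists_prod:
  fixes F :: "nat \<Rightarrow> 'a \<Rightarrow> complex"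
  assumes "finite A"
  shows "(\<Sum>l | set l \<subseteq> A \<and> length l = k. \<Prod>i<k. F i (l ! i)) = (\<Prod>i<k. \<Sum>x\<in>A. F i x)"
proof (induction k arbitrary: F)
  case 0
  have "{l. set l \<subseteq> A \<and> l = []} = {[]}" by auto
  then show ?case by simp
next
  case (Suc k)
  let ?L = "{l. set l \<subseteq> A \<and> length l = k}"
  have eq: "{l. set l \<subseteq> A \<and> length l = Suc k} = (\<lambda>(x, l). x # l) ` (A \<times> ?L)"
    by (auto simp: length_Suc_conv image_iff)
  have inj: "inj_on (\<lambda>(x, l). x # l) (A \<times> ?L)" by (auto simp: inj_on_def)
  have "(\<Sum>l | set l \<subseteq> A \<and> length l = Suc k. \<Prod>i<Suc k. F i (l ! i))
      = (\<Sum>(x, l)\<in>A \<times> ?L. F 0 x * (\<Prod>i<k. F (Suc i) (l ! i)))"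
    unfolding eq sum.reindex[OF inj] by (intro sum.cong) (auto simp: prod.lessThan_Suc_shift simp del: prod.lessThan_Suc)
  also have "\<dots> = (\<Sum>x\<in>A. F 0 x) * (\<Sum>l\<in>?L. \<Prod>i<k. F (Suc i) (l ! i))"
    by (simp add: sum.cartesian_product[symmetric] sum_product)
  also have "\<dots> = (\<Prod>i<Suc k. \<Sum>x\<in>A. F i x)"
    unfolding Suc.IH[of "\<lambda>i. F (Suc i)"] prod.lessThan_Suc_shift by simp
  finally show ?case .
qed

theorem fock_inner_wedge:
  assumes len: "length \<xi>s = k" "length \<eta>s = k" and k: "k \<le> N"
  shows "fock_inner N (wedge \<xi>s) (wedge \<eta>s) = det (mat k k (\<lambda>(i, j). ell2_inner N (\<xi>s ! i) (\<eta>s ! j)))"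
proof -
  let ?P = "{p. p permutes {..<k}}"
  let ?L = "{l. set l \<subseteq> {1..N} \<and> length l = k}"
  let ?A = "mat k k (\<lambda>(i, j). ell2_inner N (\<xi>s ! i) (\<eta>s ! j))"
  have "fock_inner N (wedge \<xi>s) (wedge \<eta>s) = (\<Sum>l\<in>?L. wedge \<xi>s l * cnj (wedge \<eta>s l) / fact k)"
    unfolding fock_inner_def using len k
    by (intro sum.mono_neutral_cong_right finite_tuples) (auto simp: tuples_def wedge_def)
  also have "\<dots> = (\<Sum>l\<in>?L. \<Sum>p\<in>?P. \<Sum>q\<in>?P. of_int (sign p) * of_int (sign q) / fact k *
      (\<Prod>i<k. (\<xi>s ! p i) (l ! i) * cnj ((\<eta>s ! q i) (l ! i))))"
    using len by (intro sum.cong refl)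
      (simp add: wedge_def sum_product sum_divide_distrib prod.distrib algebra_simps)
  also have "\<dots> = (\<Sum>p\<in>?P. \<Sum>q\<in>?P. \<Sum>l\<in>?L. of_int (sign p) * of_int (sign q) / fact k *
      (\<Prod>i<k. (\<xi>s ! p i) (l ! i) * cnj ((\<eta>s ! q i) (l ! i))))"
    by (subst sum.swap, intro sum.cong refl sum.swap)
  also have "\<dots> = (\<Sum>p\<in>?P. \<Sum>q\<in>?P. of_int (sign p) * of_int (sign q) / fact k *
      (\<Prod>i<k. ell2_inner N (\<xi>s ! p i) (\<eta>s ! q i)))"
    unfolding sum_distrib_left[symmetric] ell2_inner_def by (simp add: sum_lists_prod[symmetric])
  also have "\<dots> = (\<Sum>p\<in>?P. det ?A / fact k)"
  proof (intro sum.cong refl)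
    fix p assume "p \<in> ?P"
    then have p: "p permutes {..<k}" by simp
    then have p0: "p permutes {0..<k}" by (simp add: lessThan_atLeast0)
    let ?B = "mat k k (\<lambda>(i, j). ?A $$ (p i, j))"
    have pi: "p i < k" if "i < k" for i using permutes_in_image[OF p, of i] that by simp
    have "(\<Sum>q\<in>?P. of_int (sign p) * of_int (sign q) / fact k * (\<Prod>i<k. ell2_inner N (\<xi>s ! p i) (\<eta>s ! q i)))
        = of_int (sign p) / fact k * (\<Sum>q\<in>?P. of_int (sign q) * (\<Prod>i<k. ell2_inner N (\<xi>s ! p i) (\<eta>s ! q i)))"
      by (simp add: sum_distrib_left algebra_simps)
    also have "(\<Sum>q\<in>?P. of_int (sign q) * (\<Prod>i<k. ell2_inner N (\<xi>s ! p i) (\<eta>s ! q i))) = det ?B"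
    proof -
      have "q i < k" if "q permutes {0..<k}" "i < k" for q i using permutes_in_image[OF that(1), of i] that by simp
      then show ?thesis using pi
        by (auto simp: det_def lessThan_atLeast0 intro!: sum.cong prod.cong)
    qed
    also have "det ?B = of_int (sign p) * det ?A" by (rule det_permute_rows[OF _ p0]) simp
    finally show "(\<Sum>q\<in>?P. of_int (sign p) * of_int (sign q) / fact k * (\<Prod>i<k. ell2_inner N (\<xi>s ! p i) (\<eta>s ! q i)))
        = det ?A / fact k" by (simp add: sign_def)
  qed
  also have "\<dots> = det ?A" by (simp add: card_permutations[OF refl])
  finally show ?thesis .
qed


lemma fock_inner_wedge_degree:
  "length \<xi>s \<noteq> length \<eta>s \<Longrightarrow> fock_inner N (wedge \<xi>s) (wedge \<eta>s) = 0"
  unfolding fock_inner_def wedge_def by (intro sum.neutral) auto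

lemma adjoint_eqI:
  assumes "T \<in> fock_ops N" "S \<in> fock_ops N"
    "\<And>f g. f \<in> fock N \<Longrightarrow> g \<in> fock N \<Longrightarrow> fock_inner N (T f) g = fock_inner N f (S g)"
  shows "adjoint N T = S"
  unfolding adjoint_def using assms by (intro the1_equality[OF adjoint_exists]) auto

lemma fock_inner_add_right: "fock_inner N h (f + g) = fock_inner N h f + fock_inner N h g"
  by (metis fock_inner_add_left fock_inner_cnj complex_cnj_add)

lemma fock_ops_plus: "S \<in> fock_ops N \<Longrightarrow> T \<in> fock_ops N \<Longrightarrow> S + T \<in> fock_ops N"
  unfolding fock_ops_def by (auto simp: fock_add) (auto simp: tscale_def fun_eq_iff algebra_simps)

lemma fock_ops_comp: "S \<in> fock_ops N \<Longrightarrow> T \<in> fock_ops N \<Longrightarrow> S \<circ> T \<in> fock_ops N"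
  using fock_ops_zero[of S N] by (simp add: fock_ops_def)

lemma fock_id_fock_ops: "fock_id N \<in> fock_ops N"
  by (simp add: fock_ops_def fock_id_def fock_add fock_tscale)

lemma fermion_fock_ops: "j \<in> {1..N} \<Longrightarrow> fermion N j \<in> fock_ops N"
  unfolding fermion_def by (intro fock_ops_plus adjoint_fock_ops creation_fock_ops)

lemma adjoint_fermion:
  assumes j: "j \<in> {1..N}"
  shows "adjoint N (fermion N j) = fermion N j"
proof (rule adjoint_eqI)
  note c = creation_fock_ops[OF j]
  fix f g assume f: "f \<in> fock N" and g: "g \<in> fock N"
  have "fock_inner N (adjoint N (creation N j) f) g = fock_inner N f (creation N j g)"
    using adjoint_inner[OF c g f] by (metis fock_inner_cnj)
  then show "fock_inner N (fermion N j f) g = fock_inner N f (fermion N j g)"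
    using adjoint_inner[OF c f g] by (simp add: fermion_def fock_inner_add_left fock_inner_add_right)
qed (use j in \<open>auto intro: fermion_fock_ops\<close>)

lemma fermion_apply:
  assumes "j \<in> {1..N}" "f \<in> fock N"
  shows "fermion N j f l =
    (\<Sum>m<length l. (-1) ^ m * basis j (l ! m) * f (take m l @ drop (Suc m) l)) + f (j # l)"
  using assms by (simp add: fermion_def adjoint_creation) (simp add: creation_def)

theorem fermion_anticommute:
  assumes i: "i \<in> {1..N}" and j: "j \<in> {1..N}"
  shows "(fermion N i \<circ> fermion N j) + (fermion N j \<circ> fermion N i) = oscale (if i = j then 2 else 0) (fock_id N)"
proof
  fix f
  let ?c = "creation N"
  let ?a = "\<lambda>j. adjoint N (?c j)"
  show "((fermion N i \<circ> fermion N j) + (fermion N j \<circ> fermion N i)) f = oscale (if i = j then 2 else 0) (fock_id N) f"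
  proof (cases "f \<in> fock N")
    case False
    have "fermion N i f = 0" "fermion N j f = 0"
      using fock_ops_outside[OF fermion_fock_ops False] i j by auto
    moreover have "fermion N i 0 = 0" "fermion N j 0 = 0"
      using fock_ops_zero[OF fermion_fock_ops] i j by auto
    moreover have "oscale c (fock_id N) f = 0" for c
      using False by (simp add: oscale_def tscale_def fock_id_def fun_eq_iff)
    ultimately show ?thesis by (simp only: comp_apply plus_fun_apply[of _ _ f] add_0)
  next
    case f: True
    have cop: "?c x \<in> fock_ops N" "?a x \<in> fock_ops N" if "x \<in> {1..N}" for x
      using creation_fock_ops[OF that] adjoint_fock_ops by auto
    have cin: "?c x h \<in> fock N" "?a x h \<in> fock N" if "x \<in> {1..N}" for x h
      using cop[OF that] fock_ops_in by auto
    have aa: "?a x (?a y h) + ?a y (?a x h) = 0"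
      if x: "x \<in> {1..N}" and y: "y \<in> {1..N}" and h: "h \<in> fock N" for x y h
    proof
      fix l
      let ?p = "transpose 0 (1::nat)"
      have p: "?p permutes {..<length (x # y # l)}" by (intro permutes_swap_id) auto
      have "permute_list ?p (x # y # l) = y # x # l"
      proof (rule nth_equalityI)
        fix m assume "m < length (permute_list ?p (x # y # l))"
        then show "permute_list ?p (x # y # l) ! m = (y # x # l) ! m"
          by (subst permute_list_nth[OF p]) (auto simp: transpose_def nth_Cons split: nat.splits)
      qed simp
      then have "h (y # x # l) = - h (x # y # l)"
        using fock_antisym[OF h p] by (simp add: sign_swap_id)
      then show "(?a x (?a y h) + ?a y (?a x h)) l = 0 l"
        using adjoint_creation[OF x cin(2)[OF y, of h]] adjoint_creation[OF y cin(2)[OF x, of h]]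
          adjoint_creation[OF x h] adjoint_creation[OF y h] by simp
    qed
    have ac: "?a x (?c y h) + ?c y (?a x h) = tscale (if x = y then 1 else 0) h"
      if x: "x \<in> {1..N}" and y: "y \<in> {1..N}" and h: "h \<in> fock N" for x y h
    proof
      fix l
      have c: "?c y g l' = (\<Sum>m<length l'. (-1) ^ m * basis y (l' ! m) * g (take m l' @ drop (Suc m) l'))"
        if "g \<in> fock N" for g l' using that by (simp add: creation_def)
      have "?a x (?c y h) l = ?c y h (x # l)" using adjoint_creation[OF x cin(1)[OF y, of h]] by simp
      also have "\<dots> = (if x = y then h l else 0)
          - (\<Sum>m<length l. (-1) ^ m * basis y (l ! m) * h (x # take m l @ drop (Suc m) l))"
        unfolding c[OF h] by (simp add: sum.lessThan_Suc_shift sum_negf basis_def del: sum.lessThan_Suc)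
      also have "(\<Sum>m<length l. (-1) ^ m * basis y (l ! m) * h (x # take m l @ drop (Suc m) l)) = ?c y (?a x h) l"
        using c[OF cin(2)[OF x, of h], of l] adjoint_creation[OF x h] by simp
      finally have "?a x (?c y h) l = (if x = y then h l else 0) - ?c y (?a x h) l" .
      then show "(?a x (?c y h) + ?c y (?a x h)) l = tscale (if x = y then 1 else 0) h l"
        by (simp add: tscale_def)
    qed
    have cc: "?c i (?c j f) + ?c j (?c i f) = 0"
    proof (rule fock_inner_eqI[of _ N])
      fix h assume h: "h \<in> fock N"
      have "fock_inner N (?c i (?c j f) + ?c j (?c i f)) h = fock_inner N f (?a j (?a i h) + ?a i (?a j h))"
        using i j f h cin
        by (simp add: fock_inner_add_left fock_inner_add_right adjoint_inner[OF cop(1)[OF i]] adjoint_inner[OF cop(1)[OF j]])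
      then show "fock_inner N (?c i (?c j f) + ?c j (?c i f)) h = fock_inner N 0 h"
        using aa[OF j i h] by simp
    qed (auto intro: fock_add cin i j)
    have ff: "fermion N x (fermion N y f) = ?c x (?c y f) + ?c x (?a y f) + (?a x (?c y f) + ?a x (?a y f))"
      if x: "x \<in> {1..N}" and y: "y \<in> {1..N}" for x y
      using cin[OF y, of f] by (simp add: fermion_def fock_ops_add[OF cop(1)[OF x]] fock_ops_add[OF cop(2)[OF x]])
    have "fermion N i (fermion N j f) + fermion N j (fermion N i f)
      = (?c i (?c j f) + ?c j (?c i f)) + (?a i (?a j f) + ?a j (?a i f))
        + (?a i (?c j f) + ?c j (?a i f)) + (?a j (?c i f) + ?c i (?a j f))"
      unfolding ff[OF i j] ff[OF j i] by (simp only: ac_simps)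
    also have "\<dots> = tscale (if i = j then 2 else 0) f"
      unfolding cc aa[OF i j f] ac[OF i j f] ac[OF j i f] by (auto simp: tscale_def fun_eq_iff)
    finally show ?thesis using f by (simp add: oscale_def fock_id_def)
  qed
qed

lemma fermion_square:
  assumes "j \<in> {1..N}" shows "fermion N j \<circ> fermion N j = fock_id N"
proof
  fix f
  have "(fermion N j \<circ> fermion N j) f + (fermion N j \<circ> fermion N j) f = oscale 2 (fock_id N) f"
    using fun_cong[OF fermion_anticommute[OF assms assms], of f] by simp
  then have "2 * (fermion N j \<circ> fermion N j) f l = 2 * fock_id N f l" for l
    by (metis mult_2 oscale_def plus_fun_apply tscale_def)
  then show "(fermion N j \<circ> fermion N j) f = fock_id N f" by (intro ext) simp
qed

theorem F_space_subset_clifford: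
  assumes n: "n \<ge> 1"
  shows "F_space n \<subseteq> clifford (2 * n)"
  unfolding clifford_def
proof (intro Inter_greatest)
  fix A assume "A \<in> {A. cstar_subalgebra (2 * n) A \<and> fermion (2 * n) ` {1..2 * n} \<subseteq> A}"
  then have A: "cstar_subalgebra (2 * n) A" and w: "fermion (2 * n) ` {1..2 * n} \<subseteq> A" by auto
  have comp: "S \<circ> T \<in> A" if "S \<in> A" "T \<in> A" for S T
    using A that unfolding cstar_subalgebra_def by blast
  have w1: "fermion (2 * n) 1 \<in> A" using w n by auto
  have id: "fock_id (2 * n) \<in> A"
    using comp[OF w1 w1] fermion_square[of 1 "2 * n"] n by simp
  have "foldr (\<circ>) Ts (fock_id (2 * n)) \<in> A" if "set Ts \<subseteq> A" for Ts
    using that by (induction Ts) (auto simp: id comp)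
  from this[of "map (fermion (2 * n)) [1..<Suc (2 * n)]"] have "fermion_prod (2 * n) \<in> A"
    unfolding fermion_prod_def using w by (auto simp: image_subset_iff)
  then show "F_space n \<subseteq> A"
    unfolding F_space_def using id w A
    by (intro operators.span_minimal) (auto simp: operators.subspace_def cstar_subalgebra_def)
qed

lemma wedge_basis_self:
  assumes "distinct l" shows "wedge (map basis l) l = 1"
proof -
  have "mat (length l) (length l) (\<lambda>(i, j). (map basis l ! i) (l ! j)) = 1\<^sub>m (length l)"
    using assms by (intro eq_matI) (auto simp: basis_def nth_eq_iff_index_eq)
  then show ?thesis by (simp add: wedge_det)
qed

lemma fermions_vacuum:
  assumes "distinct l" "set l \<subseteq> {1..N}"
  shows "foldr (\<circ>) (map (fermion N) l) (fock_id N) (wedge []) = wedge (map basis l)"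
  using assms
proof (induction l)
  case Nil
  then show ?case using wedge_in_fock[of "[]" N] by (simp add: fock_id_def)
next
  case (Cons j l)
  then have j: "j \<in> {1..N}" "j \<notin> set l" by auto
  have sub: "set (map basis l) \<subseteq> ell2 N" using Cons.prems by (auto intro!: basis_in_ell2)
  have "wedge (map basis l) (j # l') = 0" for l'
  proof -
    have "j # l' \<noteq> permute_list p l" if "p permutes {..<length l}" for p
      using j(2) set_permute_list[OF that] by (metis list.set_intros(1))
    then show ?thesis unfolding wedge_basis by (intro sum.neutral) auto
  qed
  then have "adjoint N (creation N j) (wedge (map basis l)) = 0"
    by (simp add: adjoint_creation[OF j(1) wedge_in_fock[OF sub]] fun_eq_iff)
  then show ?case using Cons by (simp add: fermion_def creation_wedge[OF sub])
qed

theorem flip_exists: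
  assumes n: "n \<ge> 1"
  shows "\<exists>\<tau>. linear_map_on (F_space n) (F_space n) \<tau> \<and> \<tau> (fock_id (2 * n)) = fock_id (2 * n) \<and>
    (\<forall>j\<in>{1..2 * n}. \<tau> (fermion (2 * n) j) = fermion (2 * n) j) \<and>
    \<tau> (fermion_prod (2 * n)) = - fermion_prod (2 * n)"
proof -
  let ?N = "2 * n"
  let ?l = "[1..<Suc ?N]"
  let ?P = "fermion_prod ?N"
  define \<phi> :: "oper \<Rightarrow> complex" where "\<phi> T = T (wedge []) ?l" for T
  define \<tau> where "\<tau> T = T + oscale (- 2 * \<phi> T) ?P" for T
  have "wedge [] \<in> fock ?N" by (rule wedge_in_fock) simp
  then have id: "\<phi> (fock_id ?N) = 0"
    using n by (simp add: \<phi>_def fock_id_def wedge_def del: upt_Suc)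
  have ferm: "\<phi> (fermion ?N j) = 0" if j: "j \<in> {1..?N}" for j
  proof -
    have "fermion ?N j (wedge []) = fermion ?N j (fock_id ?N (wedge []))"
      using wedge_in_fock[of "[]" ?N] by (simp add: fock_id_def)
    also have "\<dots> = wedge [basis j]" using fermions_vacuum[of "[j]" ?N] j by simp
    finally show ?thesis using n by (simp add: \<phi>_def wedge_def del: upt_Suc)
  qed
  have prod: "\<phi> ?P = 1"
    unfolding \<phi>_def fermion_prod_def
    by (subst fermions_vacuum) (auto simp: wedge_basis_self simp del: upt_Suc)
  have P: "?P \<in> F_space n" unfolding F_space_def by (intro operators.span_base) auto
  have "\<tau> T \<in> F_space n" if "T \<in> F_space n" for T
    using that P unfolding \<tau>_def F_space_def by (intro operators.span_add operators.span_scale)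
  moreover have "\<tau> (S + T) = \<tau> S + \<tau> T" "\<tau> (oscale c T) = oscale c (\<tau> T)" for S T c
    by (auto simp: \<tau>_def \<phi>_def oscale_def tscale_def fun_eq_iff algebra_simps)
  ultimately have "linear_map_on (F_space n) (F_space n) \<tau>" unfolding linear_map_on_def by blast
  moreover have "\<tau> ?P = - ?P"
    by (simp add: \<tau>_def prod) (simp add: oscale_def tscale_def fun_eq_iff)
  moreover have "\<tau> (fock_id ?N) = fock_id ?N" "\<And>j. j \<in> {1..?N} \<Longrightarrow> \<tau> (fermion ?N j) = fermion ?N j"
    by (simp_all add: \<tau>_def id ferm)
  ultimately show ?thesis by blast
qed

end

theory Submission
  imports Defs "HOL-Analysis.L2_Norm"
begin

text \<open>
  Write \<open>N = 2n\<close> and \<open>P = \<omega>\<^sub>1 \<dots> \<omega>\<^sub>N\<close>; as \<open>N\<close> is even, \<open>P\<close> anti-commutes with every \<open>\<omega>\<^sub>j\<close>. On \<open>F\<^sub>n\<close> the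
  flip is a combination of unitary conjugations,
  \<open>\<tau>(x) = (\<Sum>\<^sub>k P \<omega>\<^sub>k x \<omega>\<^sub>k P\<^sup>*  +  x  -  P x P\<^sup>*) / N\<close>, whose coefficients have absolute sum
  \<open>(N + 2) / N\<close>. For the lower bound let \<open>\<epsilon>\<^sub>j = \<omega>\<^sub>j \<otimes> b\<^sub>j\<close>, where the \<open>b\<^sub>j\<close> are anti-commuting real symmetric
  signed permutation matrices. The \<open>\<epsilon>\<^sub>j\<close> are commuting selfadjoint involutions with product
  \<open>P \<otimes> b\<^sub>1 \<dots> b\<^sub>N\<close>. On a joint eigenvector with \<open>m\<close> eigenvalues \<open>-1\<close>, the operator
  \<open>-1 + \<Sum>\<^sub>j \<epsilon>\<^sub>j + \<Prod>\<^sub>j \<epsilon>\<^sub>j\<close> acts as \<open>-1 + N - 2m + (-1)\<^sup>m\<close>, of absolute value at most \<open>N\<close>, whereas the flipped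
  operator \<open>-1 + \<Sum>\<^sub>j \<epsilon>\<^sub>j - \<Prod>\<^sub>j \<epsilon>\<^sub>j\<close> has the eigenvalue \<open>-N - 2\<close> at \<open>m = N\<close>.
\<close>

subsection \<open>Fermions\<close>

lemma fermion_in: "j \<in> {1..N} \<Longrightarrow> fermion N j f \<in> fock N"
  by (rule fock_ops_in[OF fermion_fock_ops])

lemma fermion_add:
  "j \<in> {1..N} \<Longrightarrow> f \<in> fock N \<Longrightarrow> g \<in> fock N \<Longrightarrow> fermion N j (f + g) = fermion N j f + fermion N j g"
  by (rule fock_ops_add[OF fermion_fock_ops])

lemma fermion_tscale:
  "j \<in> {1..N} \<Longrightarrow> f \<in> fock N \<Longrightarrow> fermion N j (tscale c f) = tscale c (fermion N j f)"
  by (rule fock_ops_tscale[OF fermion_fock_ops])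

lemma fermion_inner:
  "j \<in> {1..N} \<Longrightarrow> f \<in> fock N \<Longrightarrow> g \<in> fock N \<Longrightarrow> fock_inner N (fermion N j f) g = fock_inner N f (fermion N j g)"
  using adjoint_inner[OF fermion_fock_ops] adjoint_fermion by metis

lemma fermion_fermion: "j \<in> {1..N} \<Longrightarrow> f \<in> fock N \<Longrightarrow> fermion N j (fermion N j f) = f"
  using fun_cong[OF fermion_square, of j N f] by (simp add: fock_id_def)

lemma tscale_one [simp]: "tscale 1 f = f"
  by (simp add: tscale_def)

lemma tscale_zero [simp]: "tscale 0 f = 0" "tscale c 0 = 0"
  by (simp_all add: tscale_def fun_eq_iff)

lemma tscale_tscale [simp]: "tscale c (tscale d f) = tscale (c * d) f"
  by (simp add: tscale_def mult.assoc)

lemma tscale_minus_one: "tscale (- 1) f = - f"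
  by (simp add: tscale_def fun_eq_iff)

lemma tscale_add: "tscale c (f + g) = tscale c f + tscale c g"
  by (simp add: tscale_def fun_eq_iff algebra_simps)

lemma tscale_add_left: "tscale (c + d) f = tscale c f + tscale d f"
  by (simp add: tscale_def fun_eq_iff algebra_simps)

lemma tscale_diff: "tscale c (f - g) = tscale c f - tscale c g"
  by (simp add: tscale_def fun_eq_iff algebra_simps)

lemma tscale_sum: "tscale c (\<Sum>x\<in>A. f x) = (\<Sum>x\<in>A. tscale c (f x))"
  unfolding tscale_def by (rule ext) (simp only: tensor_sum_apply sum_distrib_left)

lemma fermion_uminus: "j \<in> {1..N} \<Longrightarrow> f \<in> fock N \<Longrightarrow> fermion N j (- f) = - fermion N j f"
  using fermion_tscale[of j N f "- 1"] by (simp add: tscale_minus_one)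

lemma fermion_swap:
  assumes "i \<in> {1..N}" "j \<in> {1..N}" "i \<noteq> j" "f \<in> fock N"
  shows "fermion N i (fermion N j f) = - fermion N j (fermion N i f)"
proof -
  have "fermion N i (fermion N j f) + fermion N j (fermion N i f) = 0"
    using fun_cong[OF fermion_anticommute[OF assms(1,2)], of f] assms(3) by (simp add: oscale_def)
  then show ?thesis by (simp add: eq_neg_iff_add_eq_0)
qed

subsection \<open>Products of fermions\<close>

text \<open>No final \<open>fock_id\<close> occurs here, unlike in \<open>fermion_prod\<close>, so
  the empty word is the identity; \<open>fermion_prod_apply\<close> links the two forms on
  \<open>fock N\<close>.\<close>

abbreviation word :: "nat \<Rightarrow> nat list \<Rightarrow> oper" where
  "word N js \<equiv> foldr (fermion N) js"

lemma word_in: "set js \<subseteq> {1..N} \<Longrightarrow> f \<in> fock N \<Longrightarrow> word N js f \<in> fock N"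
  by (induction js) (auto intro: fermion_in)

lemma word_add:
  "set js \<subseteq> {1..N} \<Longrightarrow> f \<in> fock N \<Longrightarrow> g \<in> fock N \<Longrightarrow> word N js (f + g) = word N js f + word N js g"
  by (induction js) (auto simp: fermion_add word_in)

lemma word_tscale:
  "set js \<subseteq> {1..N} \<Longrightarrow> f \<in> fock N \<Longrightarrow> word N js (tscale c f) = tscale c (word N js f)"
  by (induction js) (auto simp: fermion_tscale word_in)

lemma word_uminus: "set js \<subseteq> {1..N} \<Longrightarrow> f \<in> fock N \<Longrightarrow> word N js (- f) = - word N js f"
  using word_tscale[of js N f "- 1"] by (simp add: tscale_minus_one)

lemma word_zero: "set js \<subseteq> {1..N} \<Longrightarrow> word N js 0 = 0"
  using word_tscale[of js N 0 0] by simp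

lemma word_sum:
  "set js \<subseteq> {1..N} \<Longrightarrow> (\<And>x. x \<in> A \<Longrightarrow> h x \<in> fock N) \<Longrightarrow> word N js (\<Sum>x\<in>A. h x) = (\<Sum>x\<in>A. word N js (h x))"
  by (induction A rule: infinite_finite_induct) (auto simp: word_zero word_add fock_sum)

lemma word_isometry:
  "set js \<subseteq> {1..N} \<Longrightarrow> f \<in> fock N \<Longrightarrow> fock_inner N (word N js f) (word N js f) = fock_inner N f f"
  by (induction js) (auto simp: fermion_inner fermion_fermion word_in fermion_in)

text \<open>Each fermion is its own inverse, so reversing a word inverts it. Together with
  \<open>word_isometry\<close> this makes words unitary on \<open>fock N\<close>.\<close>

lemma word_word_rev:
  "set js \<subseteq> {1..N} \<Longrightarrow> f \<in> fock N \<Longrightarrow> word N js (word N (rev js) f) = f"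
proof (induction js arbitrary: f)
  case (Cons j js)
  have "fermion N j f \<in> fock N" using Cons.prems by (intro fermion_in) auto
  then show ?case using Cons by (simp add: fermion_fermion)
qed simp

lemma word_fermion_notin:
  "set js \<subseteq> {1..N} \<Longrightarrow> j \<in> {1..N} \<Longrightarrow> j \<notin> set js \<Longrightarrow> f \<in> fock N \<Longrightarrow>
     word N js (fermion N j f) = tscale ((- 1) ^ length js) (fermion N j (word N js f))"
proof (induction js)
  case (Cons i js)
  then have "word N (i # js) (fermion N j f) = tscale ((- 1) ^ length js) (fermion N i (fermion N j (word N js f)))"
    by (simp add: fermion_tscale fermion_in)
  also have "fermion N i (fermion N j (word N js f)) = tscale (- 1) (fermion N j (fermion N i (word N js f)))"
    using Cons.prems by (subst fermion_swap) (auto simp: word_in tscale_minus_one)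
  finally show ?case by (simp add: mult.commute)
qed simp

text \<open>A letter anti-commutes with all other letters and commutes with its own single
  occurrence, hence one sign fewer than the length.\<close>

lemma word_fermion:
  assumes js: "set js \<subseteq> {1..N}" "distinct js" "j \<in> set js" and f: "f \<in> fock N"
  shows "word N js (fermion N j f) = tscale ((- 1) ^ (length js - 1)) (fermion N j (word N js f))"
proof -
  obtain us vs where s: "js = us @ j # vs" using js(3) split_list by metis
  have j: "j \<in> {1..N}" and uv: "set us \<subseteq> {1..N}" "set vs \<subseteq> {1..N}" "j \<notin> set us" "j \<notin> set vs"
    using js unfolding s by auto
  let ?g = "fermion N j (word N vs f)"
  have g: "?g \<in> fock N" using j by (rule fermion_in)
  have "word N js (fermion N j f) = word N us (fermion N j (tscale ((- 1) ^ length vs) ?g))"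
    by (simp add: s word_fermion_notin[OF uv(2) j uv(4) f])
  also have "\<dots> = tscale ((- 1) ^ (length vs + length us)) (fermion N j (word N us ?g))"
    by (simp add: fermion_tscale[OF j g] word_tscale[OF uv(1)] fermion_in[OF j]
        word_fermion_notin[OF uv(1) j uv(3) g] power_add)
  finally show ?thesis by (simp add: s add.commute)
qed

section \<open>The product of all fermions\<close>

abbreviation full :: "nat \<Rightarrow> nat list" where
  "full N \<equiv> [1..<Suc N]"

lemma set_full: "set (full N) = {1..N}"
  by (simp add: atLeastLessThanSuc_atLeastAtMost del: upt_Suc)

lemma fermion_prod_apply: "f \<in> fock N \<Longrightarrow> fermion_prod N f = word N (full N) f"
proof -
  assume "f \<in> fock N"
  then have "foldr (\<circ>) (map (fermion N) js) (fock_id N) f = word N js f" for js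
    by (induction js) (auto simp: fock_id_def)
  then show ?thesis unfolding fermion_prod_def .
qed

lemma fermion_prod_fock_ops: "fermion_prod N \<in> fock_ops N"
proof -
  have "foldr (\<circ>) (map (fermion N) js) (fock_id N) \<in> fock_ops N" if "set js \<subseteq> {1..N}" for js
    using that
  proof (induction js)
    case (Cons j js)
    have "foldr (\<circ>) (map (fermion N) js) (fock_id N) \<in> fock_ops N"
      by (rule Cons.IH) (use Cons.prems in simp)
    moreover have "fermion N j \<in> fock_ops N"
      by (rule fermion_fock_ops) (use Cons.prems in simp)
    ultimately have "fermion N j \<circ> foldr (\<circ>) (map (fermion N) js) (fock_id N) \<in> fock_ops N"
      by (intro fock_ops_comp)
    moreover have "foldr (\<circ>) (map (fermion N) (j # js)) (fock_id N)
        = fermion N j \<circ> foldr (\<circ>) (map (fermion N) js) (fock_id N)"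
      by (simp add: fun_eq_iff)
    ultimately show ?case by (simp only:)
  qed (simp add: fock_id_fock_ops)
  then show ?thesis unfolding fermion_prod_def by (metis set_full order_refl)
qed

lemma fermion_prod_fermion:
  assumes "even N" "j \<in> {1..N}" "f \<in> fock N"
  shows "word N (full N) (fermion N j f) = - fermion N j (word N (full N) f)"
proof -
  \<comment> \<open>Membership of \<open>j\<close> excludes \<open>N = 0\<close>, where truncated
    subtraction would make \<open>N - 1\<close> even.\<close>
  have "odd (N - 1)" using assms(1,2) by (cases N) auto
  moreover have "word N (full N) (fermion N j f) = tscale ((- 1) ^ (length (full N) - 1)) (fermion N j (word N (full N) f))"
    by (rule word_fermion) (simp_all only: set_full distinct_upt assms order_refl)
  ultimately show ?thesis by (simp add: tscale_minus_one del: upt_Suc)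
qed

subsection \<open>The column space\<close>

definition column_inner :: "nat \<Rightarrow> nat \<Rightarrow> (nat \<Rightarrow> tensor) \<Rightarrow> (nat \<Rightarrow> tensor) \<Rightarrow> complex" where
  "column_inner N k x y = (\<Sum>i<k. fock_inner N (x i) (y i))"

definition cscale :: "complex \<Rightarrow> (nat \<Rightarrow> tensor) \<Rightarrow> nat \<Rightarrow> tensor" where
  "cscale c x = (\<lambda>i. tscale c (x i))"

text \<open>Membership is required at every index, not only below some \<open>k\<close>, so that
  operator identities hold as equalities of functions.\<close>

definition columns :: "nat \<Rightarrow> (nat \<Rightarrow> tensor) set" where
  "columns N = {x. \<forall>i. x i \<in> fock N}"

lemma column_norm_eq: "column_norm N k x = sqrt (Re (column_inner N k x x))"
  by (simp add: column_norm_def column_inner_def)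

lemma column_norm_cong: "(\<And>i. i < k \<Longrightarrow> x i = y i) \<Longrightarrow> column_norm N k x = column_norm N k y"
  by (simp add: column_norm_def)

lemma fock_inner_self: "Re (fock_inner N f f) = (\<Sum>l\<in>tuples N. (cmod (f l))\<^sup>2 / fact (length l))"
proof -
  have "Re (f l * cnj (f l) / fact (length l)) = (cmod (f l))\<^sup>2 / fact (length l)" for l
  proof -
    have "f l * cnj (f l) / fact (length l) = complex_of_real ((cmod (f l))\<^sup>2 / fact (length l))"
      by (simp only: complex_norm_square of_real_divide of_real_fact)
    then show ?thesis by (metis Re_complex_of_real)
  qed
  then show ?thesis by (simp add: fock_inner_def)
qed

text \<open>A Euclidean norm of weighted coordinates inherits the triangle inequality; the factorial
  in \<open>fock_inner\<close> becomes the weight.\<close>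

lemma column_norm_L2:
  "column_norm N k x =
     L2_set (\<lambda>(i, l). cmod (x i l) / sqrt (fact (length l))) ({..<k} \<times> tuples N)"
  by (simp add: column_norm_def fock_inner_self L2_set_def sum.cartesian_product case_prod_beta power_divide)

lemma column_norm_nonneg: "0 \<le> column_norm N k x"
  by (simp add: column_norm_L2)

lemma column_norm_triangle: "column_norm N k (x + y) \<le> column_norm N k x + column_norm N k y"
proof -
  let ?d = "\<lambda>l :: nat list. sqrt (fact (length l)) :: real"
  have "column_norm N k (x + y)
      \<le> L2_set (\<lambda>p. (case p of (i, l) \<Rightarrow> cmod (x i l) / ?d l) + (case p of (i, l) \<Rightarrow> cmod (y i l) / ?d l))
          ({..<k} \<times> tuples N)"
    unfolding column_norm_L2
    by (intro L2_set_mono)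
      (auto simp: add_divide_distrib[symmetric] intro!: divide_right_mono norm_triangle_ineq)
  also have "\<dots> \<le> column_norm N k x + column_norm N k y"
    unfolding column_norm_L2 by (rule L2_set_triangle_ineq)
  finally show ?thesis .
qed

lemma column_inner_cnj: "cnj (column_inner N k x y) = column_inner N k y x"
  by (simp add: column_inner_def fock_inner_cnj)

lemma column_inner_cscale:
  "column_inner N k (cscale c x) y = c * column_inner N k x y"
  "column_inner N k x (cscale c y) = cnj c * column_inner N k x y"
proof -
  show l: "column_inner N k (cscale c x) y = c * column_inner N k x y" for x y
    by (simp add: column_inner_def cscale_def fock_inner_tscale_left sum_distrib_left)
  show "column_inner N k x (cscale c y) = cnj c * column_inner N k x y"
    by (subst column_inner_cnj[symmetric], subst l) (simp only: complex_cnj_mult column_inner_cnj)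
qed

lemma column_inner_add: "column_inner N k (x + y) z = column_inner N k x z + column_inner N k y z"
  by (simp only: column_inner_def plus_fun_apply fock_inner_add_left sum.distrib)

lemma column_inner_zero: "column_inner N k 0 z = 0"
  by (simp add: column_inner_def)

lemma column_inner_sum_left: "column_inner N k (sum x A) z = (\<Sum>a\<in>A. column_inner N k (x a) z)"
proof (induction A rule: infinite_finite_induct)
  case (insert a A)
  then show ?case by (simp only: sum.insert[OF insert.hyps] column_inner_add)
qed (simp_all only: sum.infinite sum.empty column_inner_zero not_False_eq_True)

lemma column_inner_sum:
  "column_inner N k (sum x A) (sum y B) = (\<Sum>a\<in>A. \<Sum>b\<in>B. column_inner N k (x a) (y b))"
proof -
  have "column_inner N k z (sum y B) = (\<Sum>b\<in>B. column_inner N k z (y b))" for z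
    by (subst column_inner_cnj[symmetric], subst column_inner_sum_left)
      (simp only: cnj_sum column_inner_cnj)
  then show ?thesis by (simp only: column_inner_sum_left)
qed

lemma column_norm_cscale: "column_norm N k (cscale c x) = cmod c * column_norm N k x"
proof -
  have "Re (column_inner N k (cscale c x) (cscale c x)) = (cmod c)\<^sup>2 * Re (column_inner N k x x)"
  proof -
    have "column_inner N k (cscale c x) (cscale c x) = of_real ((cmod c)\<^sup>2) * column_inner N k x x"
      by (simp only: column_inner_cscale complex_norm_square ac_simps)
    then show ?thesis by (metis scaleR_complex.sel(1) scaleR_conv_of_real)
  qed
  then show ?thesis by (simp add: column_norm_eq real_sqrt_mult)
qed

lemma column_norm_sum: "column_norm N k (sum x A) \<le> (\<Sum>a\<in>A. column_norm N k (x a))"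
proof (induction A rule: infinite_finite_induct)
  case (insert a A)
  then show ?case
    using column_norm_triangle[of N k "x a" "sum x A"] by (simp only: sum.insert[OF insert.hyps])
qed (simp_all only: sum.infinite sum.empty column_norm_eq column_inner_zero zero_complex.sel real_sqrt_zero order_refl not_False_eq_True)

lemma column_norm_word:
  assumes "set js \<subseteq> {1..N}" "\<And>i. i < k \<Longrightarrow> x i \<in> fock N"
  shows "column_norm N k (\<lambda>i. word N js (x i)) = column_norm N k x"
  using assms by (simp add: column_norm_def word_isometry)

lemma mat_normD:
  assumes "mat_norm N k a \<le> 1" "\<And>j. j < k \<Longrightarrow> x j \<in> fock N" "column_norm N k x \<le> 1"
  shows "column_norm N k (\<lambda>i. \<Sum>j<k. a i j (x j)) \<le> 1"
proof -
  have "ereal (column_norm N k (\<lambda>i. \<Sum>j<k. a i j (x j))) \<le> mat_norm N k a"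
    unfolding mat_norm_def by (rule SUP_upper) (use assms in auto)
  also note assms(1)
  finally show ?thesis by (simp add: one_ereal_def)
qed

section \<open>Pointwise linear structure of columns\<close>

lemma sum_fun_apply: "sum x A i = (\<Sum>a\<in>A. (x a i :: 'c :: comm_monoid_add))"
proof (induction A rule: infinite_finite_induct)
  case (insert a A)
  then show ?case by (simp only: sum.insert[OF insert.hyps] plus_fun_apply)
qed (simp_all only: sum.infinite sum.empty zero_fun_apply not_False_eq_True)

lemma cscale_apply: "cscale c x i = tscale c (x i)"
  by (simp add: cscale_def)

lemma cscale_cscale: "cscale c (cscale d x) = cscale (c * d) x"
  by (simp add: cscale_def)

lemma cscale_one [simp]: "cscale 1 x = x"
  by (simp add: cscale_def)

lemma cscale_add: "cscale c (x + y) = cscale c x + cscale c y"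
  by (rule ext) (simp only: cscale_apply plus_fun_apply tscale_add)

lemma cscale_add_left: "cscale (c + d) x = cscale c x + cscale d x"
  by (rule ext) (simp only: cscale_apply plus_fun_apply tscale_add_left)

lemma cscale_sum: "cscale c (sum x A) = (\<Sum>a\<in>A. cscale c (x a))"
  by (rule ext) (simp only: cscale_apply sum_fun_apply tscale_sum)

lemma columns_apply: "x \<in> columns N \<Longrightarrow> x i \<in> fock N"
  by (simp add: columns_def)

lemma columns_add: "x \<in> columns N \<Longrightarrow> y \<in> columns N \<Longrightarrow> x + y \<in> columns N"
  by (auto simp: columns_def)

lemma columns_cscale: "x \<in> columns N \<Longrightarrow> cscale c x \<in> columns N"
  by (auto simp: columns_def cscale_def)

lemma columns_sum: "(\<And>a. a \<in> A \<Longrightarrow> x a \<in> columns N) \<Longrightarrow> sum x A \<in> columns N"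
  unfolding columns_def by (auto simp: sum_fun_apply intro!: fock_sum)

subsection \<open>Commuting involutions on the column space\<close>

definition flip_sign :: "nat \<Rightarrow> nat \<Rightarrow> complex" where
  "flip_sign j i = (\<Prod>t<j. if bit i t then - 1 else 1)"

text \<open>
  The operator \<open>\<omega>\<^sub>j \<otimes> b\<^sub>j\<close> with a Jordan-Wigner matrix \<open>b\<^sub>j\<close>: it flips bit \<open>j\<close> of the index, with the parity of the
  lower bits as sign. Since \<open>j\<close> starts at 1, bit 0 is idle and columns of length \<open>2\<^sup>m\<close> with \<open>m > N\<close> are needed.
\<close>

definition doubled :: "nat \<Rightarrow> nat \<Rightarrow> (nat \<Rightarrow> tensor) \<Rightarrow> nat \<Rightarrow> tensor" where
  "doubled N j x = (\<lambda>i. tscale (flip_sign j i) (fermion N j (x (flip_bit j i))))"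

section \<open>Index bits and Jordan-Wigner signs\<close>

lemma bit_flip_bit_nat: "bit (flip_bit j (i :: nat)) t \<longleftrightarrow> (if t = j then \<not> bit i j else bit i t)"
  by (auto simp: bit_flip_bit_iff)

lemma flip_bit_flip_bit [simp]: "flip_bit j (flip_bit j (i :: nat)) = i"
  by (rule bit_eqI) (simp add: bit_flip_bit_nat)

lemma flip_bit_commute: "flip_bit j (flip_bit l (i :: nat)) = flip_bit l (flip_bit j i)"
  by (rule bit_eqI) (auto simp: bit_flip_bit_nat)

lemma flip_bit_less: "i < 2 ^ m \<Longrightarrow> j < m \<Longrightarrow> flip_bit j (i :: nat) < 2 ^ m"
  by (metis take_bit_flip_bit_eq take_bit_nat_eq_self_iff not_le)

lemma cnj_flip_sign [simp]: "cnj (flip_sign j i) = flip_sign j i"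
  by (auto simp: flip_sign_def intro!: prod.cong)

lemma flip_sign_square [simp]: "flip_sign j i * flip_sign j i = 1"
  unfolding flip_sign_def prod.distrib[symmetric] by (intro prod.neutral) auto

text \<open>The sign is the parity of the bits strictly below \<open>j\<close>, so only flips there
  change it. For two distinct positions this asymmetry yields exactly one extra minus sign, the
  anti-commutation of the Jordan-Wigner matrices.\<close>

lemma flip_sign_flip_bit: "flip_sign j (flip_bit l i) = (if l < j then - flip_sign j i else flip_sign j i)"
proof (cases "l < j")
  case True
  then have s: "flip_sign j i' = (if bit i' l then - 1 else 1) * (\<Prod>t\<in>{..<j} - {l}. if bit i' t then - 1 else 1)" for i'
    unfolding flip_sign_def by (intro prod.remove) auto
  have "(\<Prod>t\<in>{..<j} - {l}. if bit (flip_bit l i) t then - 1 else (1 :: complex))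
      = (\<Prod>t\<in>{..<j} - {l}. if bit i t then - 1 else 1)"
    by (intro prod.cong) (auto simp: bit_flip_bit_nat)
  then have "flip_sign j (flip_bit l i) = - flip_sign j i"
    unfolding s by (simp add: bit_flip_bit_nat)
  then show ?thesis using True by simp
next
  case False
  then show ?thesis unfolding flip_sign_def by (auto simp: bit_flip_bit_nat intro!: prod.cong)
qed

lemma doubled_in: "j \<in> {1..N} \<Longrightarrow> doubled N j x \<in> columns N"
  by (auto simp: columns_def doubled_def intro!: fock_tscale fermion_in)

lemma doubled_add:
  assumes "j \<in> {1..N}" "x \<in> columns N" "y \<in> columns N"
  shows "doubled N j (x + y) = doubled N j x + doubled N j y"
  by (rule ext)
    (simp only: doubled_def plus_fun_apply fermion_add[OF assms(1) columns_apply columns_apply, OF assms(2,3)] tscale_add)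

lemma doubled_cscale:
  assumes "j \<in> {1..N}" "x \<in> columns N"
  shows "doubled N j (cscale c x) = cscale c (doubled N j x)"
  by (rule ext)
    (simp add: doubled_def cscale_def fermion_tscale[OF assms(1) columns_apply, OF assms(2)] mult.commute)

lemma doubled_sum:
  assumes "j \<in> {1..N}" "finite A" "\<And>a. a \<in> A \<Longrightarrow> x a \<in> columns N"
  shows "doubled N j (sum x A) = (\<Sum>a\<in>A. doubled N j (x a))"
  using assms(2,3)
proof (induction A)
  case empty
  show ?case using doubled_cscale[OF assms(1), of "sum x {}" 0] columns_sum[of "{}" x N]
    by (simp add: cscale_def zero_fun_def)
next
  case (insert a A)
  have "sum x A \<in> columns N" "x a \<in> columns N" using insert.prems by (auto intro: columns_sum)
  then show ?case using insert.IH insert.prems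
    by (simp only: sum.insert[OF insert.hyps] doubled_add[OF assms(1)] insertI2)
qed

lemma doubled_doubled:
  assumes "j \<in> {1..N}" "x \<in> columns N"
  shows "doubled N j (doubled N j x) = x"
  by (rule ext)
    (simp add: doubled_def fermion_tscale[OF assms(1) fermion_in[OF assms(1)]]
      fermion_fermion[OF assms(1) columns_apply, OF assms(2)] flip_sign_flip_bit)

text \<open>For distinct indices the fermions contribute one minus sign and the Jordan-Wigner signs
  another; they cancel.\<close>

lemma doubled_commute:
  assumes j: "j \<in> {1..N}" and l: "l \<in> {1..N}" and x: "x \<in> columns N"
  shows "doubled N j (doubled N l x) = doubled N l (doubled N j x)"
proof (cases "j = l")
  case False
  show ?thesis
  proof
    fix i
    have "fermion N j (fermion N l (x i')) = tscale (- 1) (fermion N l (fermion N j (x i')))" for i'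
      using fermion_swap[OF j l False columns_apply[OF x]] by (simp add: tscale_minus_one)
    then show "doubled N j (doubled N l x) i = doubled N l (doubled N j x) i"
      using False
      by (auto simp: doubled_def fermion_tscale[OF j fermion_in[OF l]] fermion_tscale[OF l fermion_in[OF j]]
          flip_sign_flip_bit flip_bit_commute[of j l] mult.commute)
  qed
qed simp

text \<open>Fermions are selfadjoint, and flipping bit \<open>j\<close> permutes the indices below
  \<open>2 ^ m\<close>, since \<open>j \<le> N < m\<close>.\<close>

lemma doubled_inner:
  assumes j: "j \<in> {1..N}" and x: "x \<in> columns N" and y: "y \<in> columns N" and m: "N < m"
  shows "column_inner N (2 ^ m) (doubled N j x) y = column_inner N (2 ^ m) x (doubled N j y)"
proof -
  have right: "fock_inner N f (tscale c g) = cnj c * fock_inner N f g" for f g c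
    by (metis fock_inner_tscale_left fock_inner_cnj complex_cnj_mult)
  have less: "flip_bit j i < 2 ^ m" if "i < 2 ^ m" for i :: nat
    using flip_bit_less[OF that] j m by auto
  have "column_inner N (2 ^ m) (doubled N j x) y
      = (\<Sum>i<2 ^ m. flip_sign j i * fock_inner N (x (flip_bit j i)) (fermion N j (y i)))"
    using x y by (simp add: column_inner_def doubled_def fock_inner_tscale_left fermion_inner[OF j] columns_apply)
  also have "\<dots> = (\<Sum>i<2 ^ m. flip_sign j (flip_bit j i) * fock_inner N (x i) (fermion N j (y (flip_bit j i))))"
    by (rule sum.reindex_bij_witness[where i = "flip_bit j" and j = "flip_bit j"]) (auto simp: less)
  also have "\<dots> = column_inner N (2 ^ m) x (doubled N j y)"
    by (simp add: column_inner_def doubled_def right flip_sign_flip_bit)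
  finally show ?thesis .
qed

subsection \<open>Joint eigenvectors\<close>

text \<open>The set \<open>A\<close> collects the positions with eigenvalue -1, so subsets of
  \<open>{1..N}\<close> label the joint eigenspaces.\<close>

abbreviation pattern :: "nat set \<Rightarrow> nat \<Rightarrow> complex" where
  "pattern A j \<equiv> (if j \<in> A then - 1 else 1)"

text \<open>Up to a factor 1/2 this is the spectral projection of an involution: applying the
  involution exchanges the two summands, and \<open>s * s = 1\<close> restores the scalar.\<close>

lemma doubled_eigen_half:
  assumes j: "j \<in> {1..N}" and x: "x \<in> columns N" and s: "s * s = 1"
  shows "doubled N j (x + cscale s (doubled N j x)) = cscale s (x + cscale s (doubled N j x))"
  using s x by (simp only: doubled_add[OF j] doubled_cscale[OF j] columns_cscale doubled_in[OF j]
      doubled_doubled[OF j] cscale_add cscale_cscale cscale_one add.commute)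

text \<open>By induction, each component is split into its two halves under the new involution;
  commutation preserves the earlier eigenvalue equations.\<close>

lemma joint_eigenvector_decomposition:
  assumes "finite J" "J \<subseteq> {1..N}" "x \<in> columns N"
  shows "\<exists>w. (\<forall>A. w A \<in> columns N) \<and> (\<forall>A. \<forall>j\<in>J. doubled N j (w A) = cscale (pattern A j) (w A)) \<and>
    x = sum w (Pow J)"
  using assms
proof (induction J)
  case empty
  show ?case by (rule exI[of _ "\<lambda>_. x"]) (use empty in simp)
next
  case (insert j J)
  then obtain w where w: "\<And>A. w A \<in> columns N"
    and eig: "\<And>A i. i \<in> J \<Longrightarrow> doubled N i (w A) = cscale (pattern A i) (w A)"
    and x: "x = sum w (Pow J)" by (metis insert_subset)
  have j: "j \<in> {1..N}" using insert.prems by auto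
  \<comment> \<open>\<open>A - {j}\<close> names the old component, and membership of
    \<open>j\<close> in \<open>A\<close> selects the half.\<close>
  define v where "v A = cscale (1 / 2) (w (A - {j}) + cscale (pattern A j) (doubled N j (w (A - {j}))))" for A
  have in1: "w A + cscale c (doubled N j (w A)) \<in> columns N" for A c
    by (intro columns_add columns_cscale w doubled_in[OF j])
  have v: "v A \<in> columns N" for A
    unfolding v_def by (intro columns_cscale in1)
  have "doubled N i (v A) = cscale (pattern A i) (v A)" if i: "i \<in> insert j J" for A i
  proof (cases "i = j")
    case True
    then show ?thesis
      unfolding v_def by (simp only: doubled_cscale[OF j in1])
        (subst doubled_eigen_half[OF j w], auto simp: cscale_cscale)
  next
    case False
    then have iJ: "i \<in> J" and iN: "i \<in> {1..N}" using i insert.prems by auto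
    have p: "pattern (A - {j}) i = pattern A i" using False by auto
    show ?thesis unfolding v_def
      by (simp only: doubled_cscale[OF iN] in1 doubled_add[OF iN] w columns_cscale doubled_in[OF j]
          doubled_commute[OF iN j] eig[OF iJ] p doubled_cscale[OF j] cscale_add cscale_cscale mult.commute mult.left_commute)
  qed
  moreover have "x = sum v (Pow (insert j J))"
  proof -
    have "sum v (Pow (insert j J)) = sum v (Pow J) + sum v (insert j ` Pow J)"
      unfolding Pow_insert using insert.hyps by (intro sum.union_disjoint) auto
    also have "sum v (insert j ` Pow J) = (\<Sum>A\<in>Pow J. v (insert j A))"
      using insert.hyps by (intro sum.reindex[unfolded comp_def]) (auto simp: inj_on_def)
    also have "sum v (Pow J) + \<dots> = (\<Sum>A\<in>Pow J. v A + v (insert j A))"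
      by (rule sum.distrib[symmetric])
    also have "\<dots> = sum w (Pow J)"
    proof (rule sum.cong)
      fix A assume "A \<in> Pow J"
      then have "j \<notin> A" "A - {j} = A" "insert j A - {j} = A" using insert.hyps by auto
      \<comment> \<open>The two spectral projections of an involution add up to the
        identity.\<close>
      then show "v A + v (insert j A) = w A"
        by (intro ext) (simp add: v_def cscale_def tscale_def field_simps)
    qed simp
    finally show ?thesis using x by simp
  qed
  ultimately show ?case using v by blast
qed

text \<open>Symmetry moves \<open>doubled N j\<close> across the inner product; the eigenvalues at
  \<open>j\<close> are opposite, so the inner product equals its own negative.\<close>

lemma joint_eigenvectors_orthogonal:
  assumes j: "j \<in> {1..N}" and m: "N < m" and x: "x \<in> columns N" and y: "y \<in> columns N"
    and "doubled N j x = cscale (pattern A j) x" "doubled N j y = cscale (pattern B j) y"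
    and "j \<in> A \<longleftrightarrow> j \<notin> B"
  shows "column_inner N (2 ^ m) x y = 0"
proof -
  have "column_inner N (2 ^ m) (cscale (pattern A j) x) y = column_inner N (2 ^ m) x (cscale (pattern B j) y)"
    using doubled_inner[OF j x y m] unfolding assms(5,6) .
  then show ?thesis using assms(7) by (cases "j \<in> A") (simp_all add: column_inner_cscale)
qed

text \<open>Components with different sign patterns are orthogonal, so Pythagoras reduces the
  comparison of norms to single terms.\<close>

lemma column_norm_diagonal_le:
  assumes J: "finite J" "J \<subseteq> {1..N}" and m: "N < m"
    and w: "\<And>A. w A \<in> columns N"
    and eig: "\<And>A j. j \<in> J \<Longrightarrow> doubled N j (w A) = cscale (pattern A j) (w A)"
    and le: "\<And>A. A \<subseteq> J \<Longrightarrow> cmod (c A) \<le> 1"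
  shows "column_norm N (2 ^ m) (\<Sum>A\<in>Pow J. cscale (c A) (w A)) \<le> column_norm N (2 ^ m) (sum w (Pow J))"
proof -
  let ?k = "2 ^ m"
  have orth: "column_inner N ?k (w A) (w B) = 0" if "A \<in> Pow J" "B \<in> Pow J" "A \<noteq> B" for A B
  proof -
    obtain j where "j \<in> J" "j \<in> A \<longleftrightarrow> j \<notin> B" using \<open>A \<in> Pow J\<close> \<open>B \<in> Pow J\<close> \<open>A \<noteq> B\<close> by blast
    then show ?thesis using joint_eigenvectors_orthogonal[OF _ m w w eig eig] J by blast
  qed
  \<comment> \<open>Arbitrary coefficients serve both sides: \<open>d = c\<close> gives the left
    norm, constant 1 the right one.\<close>
  have sq: "Re (column_inner N ?k (\<Sum>A\<in>Pow J. cscale (d A) (w A)) (\<Sum>A\<in>Pow J. cscale (d A) (w A)))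
      = (\<Sum>A\<in>Pow J. (cmod (d A))\<^sup>2 * (column_norm N ?k (w A))\<^sup>2)" for d
  proof -
    have "column_inner N ?k (\<Sum>A\<in>Pow J. cscale (d A) (w A)) (\<Sum>A\<in>Pow J. cscale (d A) (w A))
        = (\<Sum>A\<in>Pow J. \<Sum>B\<in>Pow J. if A = B then d A * cnj (d B) * column_inner N ?k (w A) (w B) else 0)"
      unfolding column_inner_sum by (intro sum.cong refl) (auto simp: column_inner_cscale orth)
    also have "\<dots> = (\<Sum>A\<in>Pow J. d A * cnj (d A) * column_inner N ?k (w A) (w A))"
      using J by (simp add: sum.delta)
    finally have "Re (column_inner N ?k (\<Sum>A\<in>Pow J. cscale (d A) (w A)) (\<Sum>A\<in>Pow J. cscale (d A) (w A)))
        = (\<Sum>A\<in>Pow J. Re (d A * cnj (d A) * column_inner N ?k (w A) (w A)))" by (simp only: Re_sum)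
    also have "\<dots> = (\<Sum>A\<in>Pow J. (cmod (d A))\<^sup>2 * (column_norm N ?k (w A))\<^sup>2)"
    proof (intro sum.cong refl)
      fix A
      have "0 \<le> Re (column_inner N ?k (w A) (w A))"
        using column_norm_nonneg[of N ?k "w A"] by (simp add: column_norm_eq)
      then show "Re (d A * cnj (d A) * column_inner N ?k (w A) (w A))
          = (cmod (d A))\<^sup>2 * (column_norm N ?k (w A))\<^sup>2"
        unfolding complex_norm_square[symmetric] column_norm_eq
        by (metis real_sqrt_pow2 scaleR_complex.sel(1) scaleR_conv_of_real)
    qed
    finally show ?thesis .
  qed
  have "(\<Sum>A\<in>Pow J. (cmod (c A))\<^sup>2 * (column_norm N ?k (w A))\<^sup>2)
      \<le> (\<Sum>A\<in>Pow J. (cmod 1)\<^sup>2 * (column_norm N ?k (w A))\<^sup>2)"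
    using le by (intro sum_mono mult_right_mono power_mono) auto
  then show ?thesis
    unfolding column_norm_eq[of N ?k "sum _ _"] using sq[of c] sq[of "\<lambda>_. 1"] by simp
qed

subsection \<open>The extremal matrix\<close>

text \<open>A product of signed permutation matrices has one nonzero entry in row \<open>i\<close>,
  in column \<open>fold flip_bit js i\<close>; this is its sign. Each letter reads the index as
  moved by the letters before it.\<close>

fun path_sign :: "nat list \<Rightarrow> nat \<Rightarrow> complex" where
  "path_sign [] i = 1"
| "path_sign (j # js) i = flip_sign j i * path_sign js (flip_bit j i)"

lemma foldr_doubled:
  "set js \<subseteq> {1..N} \<Longrightarrow> x \<in> columns N \<Longrightarrow>
     foldr (doubled N) js x = (\<lambda>i. tscale (path_sign js i) (word N js (x (fold flip_bit js i))))"
  by (induction js) (auto simp: doubled_def fermion_tscale word_in columns_apply)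

lemma foldr_doubled_in: "set js \<subseteq> {1..N} \<Longrightarrow> x \<in> columns N \<Longrightarrow> foldr (doubled N) js x \<in> columns N"
  by (induction js) (auto intro: doubled_in)

lemma foldr_doubled_sum:
  assumes "set js \<subseteq> {1..N}" "finite A" "\<And>a. a \<in> A \<Longrightarrow> x a \<in> columns N"
  shows "foldr (doubled N) js (sum x A) = (\<Sum>a\<in>A. foldr (doubled N) js (x a))"
  using assms(1)
proof (induction js)
  case (Cons j js)
  then have "j \<in> {1..N}" "set js \<subseteq> {1..N}" by auto
  then show ?case using assms(2,3)
    by (simp only: foldr.simps o_apply Cons.IH doubled_sum foldr_doubled_in)
qed simp

lemma foldr_doubled_eigen:
  assumes "distinct js" "set js \<subseteq> {1..N}" "x \<in> columns N" "\<And>j. j \<in> set js \<Longrightarrow> doubled N j x = cscale (p j) x"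
  shows "foldr (doubled N) js x = cscale (\<Prod>j\<in>set js. p j) x"
  using assms
proof (induction js)
  case (Cons j js)
  then have "j \<in> {1..N}" "foldr (doubled N) js x = cscale (\<Prod>j\<in>set js. p j) x" by auto
  then show ?case using Cons.prems by (simp add: doubled_cscale cscale_cscale mult.commute)
qed simp

text \<open>The operator of the lower bound divided by \<open>N\<close>: \<open>c = 1\<close> is the
  original and \<open>c = - 1\<close> its flip. Each summand has a single entry per row, which the
  three conditions on \<open>i'\<close> locate. Dividing by \<open>N\<close> brings the case
  \<open>c = 1\<close> to norm at most 1.\<close>

definition test_matrix :: "nat \<Rightarrow> complex \<Rightarrow> nat \<Rightarrow> nat \<Rightarrow> oper" where
  "test_matrix N c i i' = oscale (if i' = i then - 1 / of_nat N else 0) (fock_id N)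
     + (\<Sum>j\<in>{1..N}. oscale (if i' = flip_bit j i then flip_sign j i / of_nat N else 0) (fermion N j))
     + oscale (if i' = fold flip_bit (full N) i then c * path_sign (full N) i / of_nat N else 0) (fermion_prod N)"

text \<open>The same operator in terms of the commuting involutions and without a bound on the
  index, ready for joint eigenvectors.\<close>

definition test_action :: "nat \<Rightarrow> complex \<Rightarrow> (nat \<Rightarrow> tensor) \<Rightarrow> nat \<Rightarrow> tensor" where
  "test_action N c x = cscale (1 / of_nat N)
     (cscale (- 1) x + (\<Sum>j\<in>{1..N}. doubled N j x) + cscale c (foldr (doubled N) (full N) x))"

lemma sum_tscale_delta:
  fixes m k :: nat
  assumes "m < k"
  shows "(\<Sum>i<k. tscale (if i = m then d else 0) (h i)) = tscale d (h m)"
proof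
  fix l
  have "(\<Sum>i<k. tscale (if i = m then d else 0) (h i)) l = (\<Sum>i<k. if i = m then d * h m l else 0)"
    unfolding tensor_sum_apply by (intro sum.cong) (auto simp: tscale_def)
  also have "\<dots> = tscale d (h m) l" using assms by (simp add: tscale_def)
  finally show "(\<Sum>i<k. tscale (if i = m then d else 0) (h i)) l = tscale d (h m) l" .
qed

lemma fold_flip_bit_less: "i < 2 ^ m \<Longrightarrow> set js \<subseteq> {..<m} \<Longrightarrow> fold flip_bit js (i :: nat) < 2 ^ m"
  by (induction js arbitrary: i) (auto simp: flip_bit_less)

lemma test_matrix_action:
  assumes x: "x \<in> columns N" and m: "N < m" and i: "i < 2 ^ m"
  shows "(\<Sum>i'<2 ^ m. test_matrix N c i i' (x i')) = test_action N c x i"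
proof -
  let ?L = "full N"
  have app: "test_matrix N c i i' (x i') = tscale (if i' = i then - 1 / of_nat N else 0) (x i')
     + (\<Sum>j\<in>{1..N}. tscale (if i' = flip_bit j i then flip_sign j i / of_nat N else 0) (fermion N j (x i')))
     + tscale (if i' = fold flip_bit ?L i then c * path_sign ?L i / of_nat N else 0) (word N ?L (x i'))" for i'
    by (simp only: test_matrix_def plus_fun_apply sum_fun_apply
        oscale_def fermion_prod_apply[OF columns_apply[OF x]] fock_id_def columns_apply[OF x] if_True)
  \<comment> \<open>\<open>N < m\<close> keeps the columns selected by the deltas inside the range
    of summation.\<close>
  have less: "flip_bit j i < 2 ^ m" if "j \<in> {1..N}" for j
    using flip_bit_less[OF i] that m by auto
  have less': "fold flip_bit ?L i < 2 ^ m"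
    by (rule fold_flip_bit_less[OF i]) (use m in auto)
  have "(\<Sum>i'<2 ^ m. test_matrix N c i i' (x i')) = tscale (- 1 / of_nat N) (x i)
     + (\<Sum>j\<in>{1..N}. tscale (flip_sign j i / of_nat N) (fermion N j (x (flip_bit j i))))
     + tscale (c * path_sign ?L i / of_nat N) (word N ?L (x (fold flip_bit ?L i)))"
    unfolding app sum.distrib sum_tscale_delta[OF i] sum_tscale_delta[OF less']
    by (subst sum.swap) (simp only: sum_tscale_delta[OF less] cong: sum.cong)
  also have "\<dots> = test_action N c x i"
    unfolding test_action_def foldr_doubled[OF eq_refl[OF set_full] x]
    by (simp only: cscale_apply plus_fun_apply sum_fun_apply doubled_def
        tscale_add tscale_sum tscale_tscale) (simp add: mult.commute)
  finally show ?thesis .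
qed

section \<open>Eigenvalues and norms of the extremal operator\<close>

definition test_eigenvalue :: "nat \<Rightarrow> complex \<Rightarrow> nat set \<Rightarrow> complex" where
  "test_eigenvalue N c A = (- 1 + (\<Sum>j\<in>{1..N}. pattern A j) + c * (\<Prod>j\<in>{1..N}. pattern A j)) / of_nat N"

lemma cscale_sum_left: "(\<Sum>j\<in>A. cscale (p j) x) = cscale (sum p A) x"
  by (intro ext) (simp add: sum_fun_apply cscale_def tscale_def sum_distrib_right)

lemma test_action_eigen:
  assumes "x \<in> columns N" "\<And>j. j \<in> {1..N} \<Longrightarrow> doubled N j x = cscale (pattern A j) x"
  shows "test_action N c x = cscale (test_eigenvalue N c A) x"
proof -
  have "foldr (doubled N) (full N) x = cscale (\<Prod>j\<in>{1..N}. pattern A j) x"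
    using foldr_doubled_eigen[of "full N" N x "pattern A"] assms by (simp only: set_full distinct_upt order_refl)
  moreover have "(\<Sum>j\<in>{1..N}. doubled N j x) = cscale (\<Sum>j\<in>{1..N}. pattern A j) x"
    unfolding cscale_sum_left[symmetric] by (intro sum.cong refl assms(2))
  ultimately have "test_action N c x = cscale (1 / of_nat N)
     (cscale (- 1) x + cscale (\<Sum>j\<in>{1..N}. pattern A j) x + cscale c (cscale (\<Prod>j\<in>{1..N}. pattern A j) x))"
    unfolding test_action_def by (simp only:)
  also have "\<dots> = cscale (test_eigenvalue N c A) x"
    unfolding cscale_cscale cscale_add_left[symmetric] test_eigenvalue_def by (simp only: mult_1 times_divide_eq_left)
  finally show ?thesis .
qed

lemma test_action_sum:
  assumes "finite B" "\<And>b. b \<in> B \<Longrightarrow> w b \<in> columns N"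
  shows "test_action N c (sum w B) = (\<Sum>b\<in>B. test_action N c (w b))"
proof -
  have "foldr (doubled N) (full N) (sum w B) = (\<Sum>b\<in>B. foldr (doubled N) (full N) (w b))"
    using assms by (intro foldr_doubled_sum) (auto simp: set_full simp del: upt_Suc)
  moreover have "(\<Sum>j\<in>{1..N}. doubled N j (sum w B)) = (\<Sum>b\<in>B. \<Sum>j\<in>{1..N}. doubled N j (w b))"
    by (subst sum.swap) (intro sum.cong refl doubled_sum assms)
  ultimately show ?thesis
    unfolding test_action_def by (simp only: cscale_sum sum.distrib[symmetric])
qed

lemma test_eigenvalue_eq:
  assumes "A \<subseteq> {1..N}"
  shows "test_eigenvalue N c A = (- 1 + (of_nat N - 2 * of_nat (card A)) + c * (- 1) ^ card A) / of_nat N"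
proof -
  have fin: "finite A" using assms finite_subset by blast
  have A: "{j \<in> {1..N}. j \<in> A} = A" "{1..N} \<inter> A = A" using assms by auto
  have "card ({1..N} - A) = N - card A" "card A \<le> N"
    using card_Diff_subset[OF fin assms] card_mono[OF _ assms] by auto
  moreover have "(\<Sum>j\<in>{1..N}. pattern A j) = - of_nat (card A) + of_nat (card ({1..N} - A))"
    using A by (simp add: sum.If_cases Diff_eq)
  moreover have "(\<Prod>j\<in>{1..N}. pattern A j) = (- 1) ^ card A"
    using A by (simp add: prod.If_cases)
  ultimately show ?thesis by (simp add: test_eigenvalue_def of_nat_diff)
qed

lemma test_eigenvalue_le:
  assumes A: "A \<subseteq> {1..N}" and N: "even N" "N > 0"
  shows "cmod (test_eigenvalue N 1 A) \<le> 1"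
proof -
  define e :: real where "e = - 1 + (real N - 2 * real (card A)) + (- 1) ^ card A"
  have le: "card A \<le> N" using card_mono[OF _ A] by simp
  have "\<bar>e\<bar> \<le> real N"
  proof (cases "even (card A)")
    case True
    then show ?thesis using le by (simp add: e_def abs_le_iff)
  next
    case False
    \<comment> \<open>An odd \<open>card A\<close> cannot equal the even \<open>N\<close>. This gap
      absorbs the parity term, which lowers the numerator to
      \<open>N - 2 * (card A + 1)\<close>.\<close>
    then have "card A + 1 \<le> N" using le N by (metis Suc_eq_plus1 le_neq_implies_less Suc_leI)
    then have "real (card A) + 1 \<le> real N" by linarith
    then show ?thesis using False by (simp add: e_def abs_le_iff)
  qed
  moreover have "test_eigenvalue N 1 A = of_real (e / real N)"
    by (simp add: test_eigenvalue_eq[OF A] e_def)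
  ultimately show ?thesis using N(2) by (simp only: norm_of_real) simp
qed

lemma mat_norm_test_matrix_le:
  assumes N: "even N" "N > 0" and m: "N < m"
  shows "mat_norm N (2 ^ m) (test_matrix N 1) \<le> 1"
  unfolding mat_norm_def
proof (rule SUP_least)
  fix x assume x: "x \<in> {x. (\<forall>j<2 ^ m. x j \<in> fock N) \<and> column_norm N (2 ^ m) x \<le> 1}"
  \<comment> \<open>Only entries below \<open>2 ^ m\<close> are known to be Fock vectors; setting
    the others to 0 does not affect the norm.\<close>
  define y where "y = (\<lambda>i. if i < 2 ^ m then x i else 0)"
  have y: "y \<in> columns N" using x by (auto simp: y_def columns_def)
  have xy: "x i = y i" if "i < 2 ^ m" for i using that by (simp add: y_def)
  obtain w where w: "\<And>A. w A \<in> columns N"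
    and eig: "\<And>A j. j \<in> {1..N} \<Longrightarrow> doubled N j (w A) = cscale (pattern A j) (w A)"
    and yw: "y = sum w (Pow {1..N})"
    using joint_eigenvector_decomposition[of "{1..N}" N y] y by (metis finite_atLeastAtMost order_refl)
  have "column_norm N (2 ^ m) (\<lambda>i. \<Sum>j<2 ^ m. test_matrix N 1 i j (x j))
      = column_norm N (2 ^ m) (test_action N 1 y)"
    by (rule column_norm_cong) (simp add: xy test_matrix_action[OF y m, symmetric])
  also have "test_action N 1 y = (\<Sum>A\<in>Pow {1..N}. cscale (test_eigenvalue N 1 A) (w A))"
    unfolding yw test_action_sum[OF finite_Pow_iff[THEN iffD2, OF finite_atLeastAtMost] w]
    by (intro sum.cong refl test_action_eigen w eig)
  also have "column_norm N (2 ^ m) \<dots> \<le> column_norm N (2 ^ m) (sum w (Pow {1..N}))"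
    by (rule column_norm_diagonal_le[OF _ order_refl m w eig test_eigenvalue_le[OF _ N]]) auto
  also have "\<dots> = column_norm N (2 ^ m) x"
    unfolding yw[symmetric] by (rule column_norm_cong) (simp add: xy)
  also have "\<dots> \<le> 1" using x by simp
  finally show "ereal (column_norm N (2 ^ m) (\<lambda>i. \<Sum>j<2 ^ m. test_matrix N 1 i j (x j))) \<le> 1"
    by (simp add: one_ereal_def)
qed

text \<open>
  The vector is \<open>\<Prod>\<^sub>j (1 - \<epsilon>\<^sub>j)\<close> applied to \<open>\<Omega>\<close> at index 0; tracking which bits of the index can be set shows that
  its component at index 0 remains \<open>\<Omega>\<close>, so that it is nonzero.
\<close>

lemma joint_negative_eigenvector:
  assumes "finite J" "J \<subseteq> {1..N}"
  shows "\<exists>v\<in>columns N. (\<forall>j\<in>J. doubled N j v = cscale (- 1) v) \<and> v 0 = wedge [] \<and>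
    (\<forall>i t. t \<notin> J \<longrightarrow> bit i t \<longrightarrow> v i = 0)"
  using assms
proof (induction J)
  case empty
  have "wedge [] \<in> fock N" by (rule wedge_in_fock) simp
  then show ?case
    by (intro bexI[of _ "\<lambda>i. if i = 0 then wedge [] else 0"]) (auto simp: columns_def)
next
  case (insert j J)
  then obtain v where v: "v \<in> columns N" and eig: "\<forall>i\<in>J. doubled N i v = cscale (- 1) v"
    and v0: "v 0 = wedge []" and supp: "\<forall>i t. t \<notin> J \<longrightarrow> bit i t \<longrightarrow> v i = 0" by blast
  have j: "j \<in> {1..N}" using insert.prems by simp
  define u where "u = v + cscale (- 1) (doubled N j v)"
  have f0: "fermion N j 0 = 0" by (rule fock_ops_zero[OF fermion_fock_ops[OF j]])
  have u_apply: "u i = v i + tscale (- flip_sign j i) (fermion N j (v (flip_bit j i)))" for i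
    by (simp add: u_def cscale_def doubled_def)
  have "u \<in> columns N" unfolding u_def by (intro columns_add columns_cscale v doubled_in[OF j])
  moreover have "doubled N i u = cscale (- 1) u" if i: "i \<in> insert j J" for i
  proof (cases "i = j")
    case True
    then show ?thesis unfolding u_def using doubled_eigen_half[OF j v, of "- 1"] by simp
  next
    case False
    then have iJ: "i \<in> J" and iN: "i \<in> {1..N}" using i insert.prems by auto
    show ?thesis unfolding u_def
      by (simp only: doubled_add[OF iN] v columns_cscale doubled_in[OF j] doubled_cscale[OF iN]
          doubled_commute[OF iN j] eig[rule_format, OF iJ] doubled_cscale[OF j] cscale_add)
  qed
  moreover have "u 0 = wedge []"
  proof -
    \<comment> \<open>Setting bit \<open>j\<close> leaves the support of \<open>v\<close>, as
      \<open>j\<close> is not in \<open>J\<close>; the new summand therefore leaves the component at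
      index 0 unchanged.\<close>
    have "v (flip_bit j 0) = 0" 
      by (rule supp[rule_format, OF insert.hyps(2)], unfold bit_flip_bit_nat) simp
    then show ?thesis unfolding u_apply by (simp only: f0 tscale_zero v0 add_0_right)
  qed
  moreover have "u i = 0" if "t \<notin> insert j J" "bit i t" for i t
  proof -
    have "v i = 0" "v (flip_bit j i) = 0"
      using that by (auto intro!: supp[rule_format, of t] simp: bit_flip_bit_nat)
    then show ?thesis unfolding u_apply by (simp only: f0 tscale_zero add_0_right)
  qed
  ultimately show ?case by blast
qed

lemma mat_norm_test_matrix_ge:
  assumes N: "even N" "N > 0" and m: "N < m"
  shows "ereal ((real N + 2) / real N) \<le> mat_norm N (2 ^ m) (test_matrix N (- 1))"
proof -
  obtain v where v: "v \<in> columns N" and eig: "\<And>j. j \<in> {1..N} \<Longrightarrow> doubled N j v = cscale (- 1) v"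
    and v0: "v 0 = wedge []"
    using joint_negative_eigenvector[of "{1..N}" N] by blast
  define r where "r = column_norm N (2 ^ m) v"
  have "wedge [] [] = 1" using wedge_basis_self[of "[]"] by simp
  then have "fock_inner N (v 0) (v 0) = 1"
    using fock_inner_wedge_basis[of "v 0" N "[]"] columns_apply[OF v, of 0] by (simp add: v0 tuples_def)
  \<comment> \<open>The unit vector at index 0 already bounds the norm of \<open>v\<close> below, so
    \<open>v\<close> can be normalised.\<close>
  moreover have "Re (fock_inner N (v 0) (v 0)) \<le> (\<Sum>i<2 ^ m. Re (fock_inner N (v i) (v i)))"
    by (rule member_le_sum) (auto simp: fock_inner_self intro!: sum_nonneg)
  ultimately have r: "r > 0" by (simp add: r_def column_norm_def)
  define u where "u = cscale (of_real (1 / r)) v"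
  have u: "u \<in> columns N" unfolding u_def by (rule columns_cscale[OF v])
  have u1: "column_norm N (2 ^ m) u = 1"
    using r unfolding u_def column_norm_cscale by (simp add: r_def[symmetric] norm_divide)
  have "doubled N j u = cscale (pattern {1..N} j) u" if "j \<in> {1..N}" for j
    unfolding u_def by (simp only: doubled_cscale[OF that v] eig[OF that] cscale_cscale that if_True mult.commute)
  then have "test_action N (- 1) u = cscale (test_eigenvalue N (- 1) {1..N}) u"
    by (intro test_action_eigen[OF u])
  \<comment> \<open>With all signs -1 and \<open>N\<close> even, the numerator is
    \<open>- 1 + (N - 2 * N) - 1 = - (N + 2)\<close>.\<close>
  moreover have "test_eigenvalue N (- 1) {1..N} = of_real (- ((real N + 2) / real N))"
    using N by (simp add: test_eigenvalue_eq field_simps)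
  ultimately have "column_norm N (2 ^ m) (test_action N (- 1) u) = (real N + 2) / real N"
    by (simp only: column_norm_cscale u1 norm_of_real) simp
  moreover have "column_norm N (2 ^ m) (\<lambda>i. \<Sum>j<2 ^ m. test_matrix N (- 1) i j (u j))
      = column_norm N (2 ^ m) (test_action N (- 1) u)"
    by (rule column_norm_cong) (rule test_matrix_action[OF u m])
  moreover have "ereal (column_norm N (2 ^ m) (\<lambda>i. \<Sum>j<2 ^ m. test_matrix N (- 1) i j (u j)))
      \<le> mat_norm N (2 ^ m) (test_matrix N (- 1))"
    unfolding mat_norm_def by (rule SUP_upper) (use u u1 in \<open>auto simp: columns_def\<close>)
  ultimately show ?thesis by simp
qed

subsection \<open>The flip as a combination of conjugations\<close>

lemma linear_map_onD:
  assumes "linear_map_on V W \<phi>"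
  shows "S \<in> V \<Longrightarrow> T \<in> V \<Longrightarrow> \<phi> (S + T) = \<phi> S + \<phi> T" "T \<in> V \<Longrightarrow> \<phi> (oscale c T) = oscale c (\<phi> T)"
  using assms unfolding linear_map_on_def by blast+

lemma F_space_add: "S \<in> F_space n \<Longrightarrow> T \<in> F_space n \<Longrightarrow> S + T \<in> F_space n"
  unfolding F_space_def by (rule operators.span_add)

lemma F_space_oscale: "T \<in> F_space n \<Longrightarrow> oscale c T \<in> F_space n"
  unfolding F_space_def by (rule operators.span_scale)

lemma F_space_sum: "(\<And>a. a \<in> A \<Longrightarrow> T a \<in> F_space n) \<Longrightarrow> sum T A \<in> F_space n"
  unfolding F_space_def by (rule operators.span_sum)

lemma F_space_generators:
  "fock_id (2 * n) \<in> F_space n"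
  "j \<in> {1..2 * n} \<Longrightarrow> fermion (2 * n) j \<in> F_space n"
  "fermion_prod (2 * n) \<in> F_space n"
  unfolding F_space_def by (auto intro: operators.span_base)

lemma linear_map_on_zero:
  assumes "linear_map_on (F_space n) W \<phi>"
  shows "\<phi> 0 = 0"
proof -
  have 0: "0 \<in> F_space n" unfolding F_space_def by (rule operators.span_zero)
  have "\<phi> (oscale 0 0) = oscale 0 (\<phi> 0)" by (rule linear_map_onD(2)[OF assms 0])
  then show ?thesis unfolding operators.scale_zero_left .
qed

lemma linear_map_on_sum:
  assumes "linear_map_on (F_space n) W \<phi>" "finite A" "\<And>a. a \<in> A \<Longrightarrow> T a \<in> F_space n"
  shows "\<phi> (sum T A) = (\<Sum>a\<in>A. \<phi> (T a))"
  using assms(2,3)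
proof (induction A)
  case empty
  show ?case by (simp only: sum.empty linear_map_on_zero[OF assms(1)])
next
  case (insert a A)
  have "sum T A \<in> F_space n" "T a \<in> F_space n" using insert.prems by (auto intro: F_space_sum)
  then show ?case using insert.IH insert.prems
    by (simp only: sum.insert[OF insert.hyps] linear_map_onD(1)[OF assms(1)] insertI2)
qed

lemma test_matrix_in: "test_matrix (2 * n) c i i' \<in> F_space n"
  unfolding test_matrix_def
  by (intro F_space_add F_space_oscale F_space_sum F_space_generators)

lemma flip_test_matrix:
  assumes lin: "linear_map_on (F_space n) (F_space n) \<tau>"
    and "\<tau> (fock_id (2 * n)) = fock_id (2 * n)"
    and ferm: "\<forall>j\<in>{1..2 * n}. \<tau> (fermion (2 * n) j) = fermion (2 * n) j"
    and prod: "\<tau> (fermion_prod (2 * n)) = - fermion_prod (2 * n)"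
  shows "\<tau> (test_matrix (2 * n) 1 i i') = test_matrix (2 * n) (- 1) i i'"
proof -
  let ?N = "2 * n"
  note D = linear_map_onD[OF lin]
  have s: "\<tau> (\<Sum>j\<in>{1..?N}. oscale (p j) (fermion ?N j)) = (\<Sum>j\<in>{1..?N}. oscale (p j) (fermion ?N j))" for p
  proof -
    have "\<tau> (\<Sum>j\<in>{1..?N}. oscale (p j) (fermion ?N j)) = (\<Sum>j\<in>{1..?N}. \<tau> (oscale (p j) (fermion ?N j)))"
      by (rule linear_map_on_sum[OF lin]) (simp, intro F_space_oscale F_space_generators)
    also have "\<dots> = (\<Sum>j\<in>{1..?N}. oscale (p j) (fermion ?N j))"
      by (intro sum.cong refl) (simp only: D(2) F_space_generators ferm[rule_format])
    finally show ?thesis .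
  qed
  have "\<tau> (oscale a (fock_id ?N) + (\<Sum>j\<in>{1..?N}. oscale (p j) (fermion ?N j)) + oscale b (fermion_prod ?N))
      = oscale a (fock_id ?N) + (\<Sum>j\<in>{1..?N}. oscale (p j) (fermion ?N j)) + oscale (- b) (fermion_prod ?N)" for a b p
  proof -
    have "(\<Sum>j\<in>{1..?N}. oscale (p j) (fermion ?N j)) \<in> F_space n"
      by (intro F_space_sum F_space_oscale F_space_generators)
    then show ?thesis
      by (simp only: D F_space_add F_space_oscale F_space_generators assms(2) s prod
          operators.scale_minus_right operators.scale_minus_left)
  qed
  \<comment> \<open>Passing from \<open>c = 1\<close> to \<open>c = - 1\<close> negates the last
    coefficient of \<open>test_matrix\<close>.\<close>
  moreover have "(if P then - 1 * d / e else 0) = - (if P then 1 * d / e else (0 :: complex))" for P d e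
    by simp
  ultimately show ?thesis unfolding test_matrix_def by (simp only:)
qed

section \<open>Conjugation by words of fermions\<close>

definition conjugate :: "nat \<Rightarrow> nat list \<Rightarrow> oper \<Rightarrow> oper" where
  "conjugate N js T f = word N js (T (word N (rev js) f))"

lemma conjugate_add:
  assumes "set js \<subseteq> {1..N}" "S \<in> fock_ops N" "T \<in> fock_ops N"
  shows "conjugate N js (S + T) f = conjugate N js S f + conjugate N js T f"
  unfolding conjugate_def plus_fun_apply[of S T] by (rule word_add[OF assms(1) fock_ops_in fock_ops_in, OF assms(2,3)])

lemma conjugate_oscale:
  assumes "set js \<subseteq> {1..N}" "T \<in> fock_ops N"
  shows "conjugate N js (oscale c T) f = tscale c (conjugate N js T f)"
  unfolding conjugate_def oscale_def by (rule word_tscale[OF assms(1) fock_ops_in[OF assms(2)]])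

lemma fock_ops_oscale: "T \<in> fock_ops N \<Longrightarrow> oscale c T \<in> fock_ops N"
  unfolding fock_ops_def oscale_def by (auto simp: tscale_add mult.commute)

lemma full_subset: "set (full N) \<subseteq> {1..N}"
  by (simp only: set_full order_refl)

lemma full_snoc_subset: "k \<in> {1..N} \<Longrightarrow> set (full N @ [k]) \<subseteq> {1..N}"
  using full_subset[of N] by (simp del: upt_Suc set_upt)

text \<open>The weights are fitted to the generators: the bracket multiplies the identity by
  \<open>N + 1 - 1\<close>, a fermion by \<open>(N - 2) + 1 + 1\<close> and the full product by
  \<open>- N + 1 - 1\<close>. Dividing by \<open>N\<close> leaves 1, 1 and -1.\<close>

definition flip_average :: "nat \<Rightarrow> oper \<Rightarrow> oper" where
  "flip_average N T f = tscale (1 / of_nat N)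
     ((\<Sum>k\<in>{1..N}. conjugate N (full N @ [k]) T f) + T f - conjugate N (full N) T f)"

lemma flip_average_add:
  assumes "S \<in> fock_ops N" "T \<in> fock_ops N"
  shows "flip_average N (S + T) f = flip_average N S f + flip_average N T f"
proof -
  have "(\<Sum>k\<in>{1..N}. conjugate N (full N @ [k]) (S + T) f)
      = (\<Sum>k\<in>{1..N}. conjugate N (full N @ [k]) S f + conjugate N (full N @ [k]) T f)"
    by (intro sum.cong refl conjugate_add assms full_snoc_subset)
  moreover have "conjugate N (full N) (S + T) f = conjugate N (full N) S f + conjugate N (full N) T f"
    by (intro conjugate_add assms full_subset)
  ultimately show ?thesis
    unfolding flip_average_def tscale_add[symmetric] by (simp only: sum.distrib plus_fun_apply[of S T]) (simp add: algebra_simps)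
qed

lemma flip_average_oscale:
  assumes "T \<in> fock_ops N"
  shows "flip_average N (oscale c T) f = tscale c (flip_average N T f)"
proof -
  have "(\<Sum>k\<in>{1..N}. conjugate N (full N @ [k]) (oscale c T) f)
      = tscale c (\<Sum>k\<in>{1..N}. conjugate N (full N @ [k]) T f)"
    unfolding tscale_sum
    by (intro sum.cong refl conjugate_oscale assms full_snoc_subset)
  moreover have "conjugate N (full N) (oscale c T) f = tscale c (conjugate N (full N) T f)"
    by (intro conjugate_oscale assms full_subset)
  moreover have "oscale c T f = tscale c (T f)" by (simp add: oscale_def)
  ultimately show ?thesis
    unfolding flip_average_def
    by (simp only: tscale_add[symmetric] tscale_diff[symmetric] tscale_tscale mult.commute)
qed

lemma conjugate_full_snoc: "conjugate N (full N @ [k]) T f = word N (full N) (fermion N k (T (fermion N k (word N (rev (full N)) f))))"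
  by (simp add: conjugate_def del: upt_Suc)

lemma word_rev_full_in: "f \<in> fock N \<Longrightarrow> word N (rev (full N)) f \<in> fock N"
  by (rule word_in) (simp_all only: set_rev full_subset)

lemma flip_average_id:
  assumes "N > 0" "f \<in> fock N"
  shows "flip_average N (fock_id N) f = f"
proof -
  have c: "conjugate N js (fock_id N) f = f" if "set js \<subseteq> {1..N}" for js
    using that assms(2) word_in[of "rev js" N f] by (simp add: conjugate_def fock_id_def word_word_rev)
  have "(\<Sum>k\<in>{1..N}. conjugate N (full N @ [k]) (fock_id N) f) = (\<Sum>k\<in>{1..N}. f)"
    by (intro sum.cong refl c full_snoc_subset)
  then show ?thesis using assms
    unfolding flip_average_def c[OF full_subset]
    by (intro ext) (simp add: fock_id_def tscale_def tensor_sum_apply)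
qed

lemma flip_average_fermion:
  assumes N: "even N" "N > 0" and j: "j \<in> {1..N}" and f: "f \<in> fock N"
  shows "flip_average N (fermion N j) f = fermion N j f"
proof -
  let ?g = "fermion N j f" and ?h = "word N (rev (full N)) f"
  have h: "?h \<in> fock N" by (rule word_rev_full_in[OF f])
  have c: "conjugate N (full N) (fermion N j) f = - ?g"
    unfolding conjugate_def fermion_prod_fermion[OF N(1) j h] word_word_rev[OF full_subset f] ..
  \<comment> \<open>The full product contributes a minus sign for every \<open>k\<close>, and
    \<open>fermion N k\<close> a second one unless \<open>k = j\<close>. This leaves
    \<open>N - 1\<close> plus signs and one minus.\<close>
  have "conjugate N (full N @ [k]) (fermion N j) f = tscale (if k = j then - 1 else 1) ?g" if k: "k \<in> {1..N}" for k
  proof (cases "k = j")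
    case True
    have "conjugate N (full N @ [k]) (fermion N j) f = conjugate N (full N) (fermion N j) f"
      unfolding conjugate_full_snoc unfolding True conjugate_def by (simp only: fermion_fermion[OF j h])
    then show ?thesis using True c by (simp add: tscale_minus_one del: upt_Suc)
  next
    case False
    have "fermion N k (fermion N j (fermion N k ?h)) = - fermion N j ?h"
      using fermion_swap[OF k j False fermion_in[OF k]] by (simp only: fermion_fermion[OF k h])
    then have "conjugate N (full N @ [k]) (fermion N j) f = - conjugate N (full N) (fermion N j) f"
      unfolding conjugate_full_snoc unfolding conjugate_def
      by (simp only: word_uminus[OF full_subset fermion_in[OF j]])
    then show ?thesis using False c by simp
  qed
  then have "(\<Sum>k\<in>{1..N}. conjugate N (full N @ [k]) (fermion N j) f) = (\<Sum>k\<in>{1..N}. tscale (if k = j then - 1 else 1) ?g)"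
    by (intro sum.cong) auto
  also have "\<dots> = tscale (of_nat N - 2) ?g"
  proof
    fix l
    have "(\<Sum>k\<in>{1..N}. tscale (if k = j then - 1 else 1) ?g) l = (\<Sum>k\<in>{1..N}. ?g l + (if k = j then - 2 * ?g l else 0))"
      unfolding tensor_sum_apply by (intro sum.cong) (auto simp: tscale_def)
    also have "\<dots> = tscale (of_nat N - 2) ?g l"
      using j unfolding sum.distrib by (simp add: tscale_def algebra_simps)
    finally show "(\<Sum>k\<in>{1..N}. tscale (if k = j then - 1 else 1) ?g) l = tscale (of_nat N - 2) ?g l" .
  qed
  finally have s: "(\<Sum>k\<in>{1..N}. conjugate N (full N @ [k]) (fermion N j) f) = tscale (of_nat N - 2) ?g" .
  show ?thesis unfolding flip_average_def s c
    using N(2) by (intro ext) (simp add: tscale_def field_simps)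
qed

lemma flip_average_fermion_prod:
  assumes N: "even N" "N > 0" and f: "f \<in> fock N"
  shows "flip_average N (fermion_prod N) f = - fermion_prod N f"
proof -
  let ?L = "full N" let ?g = "word N ?L f" and ?h = "word N (rev ?L) f"
  have h: "?h \<in> fock N" by (rule word_rev_full_in[OF f])
  have Lh: "word N ?L ?h = f" by (rule word_word_rev[OF full_subset f])
  have c: "conjugate N ?L (fermion_prod N) f = ?g"
    unfolding conjugate_def fermion_prod_apply[OF h] Lh ..
  have "conjugate N (?L @ [k]) (fermion_prod N) f = - ?g" if k: "k \<in> {1..N}" for k
  proof -
    \<comment> \<open>Conjugation by the full product fixes it, but conjugation by a single fermion
      negates it by anti-commutation.\<close>
    have "fermion N k (fermion_prod N (fermion N k ?h)) = - f"
      unfolding fermion_prod_apply[OF fermion_in[OF k]] fermion_prod_fermion[OF N(1) k h] Lh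
      by (simp only: fermion_uminus[OF k fermion_in[OF k]] fermion_fermion[OF k f])
    then show ?thesis unfolding conjugate_full_snoc by (simp only: word_uminus[OF full_subset f])
  qed
  then have "(\<Sum>k\<in>{1..N}. conjugate N (?L @ [k]) (fermion_prod N) f) = (\<Sum>k\<in>{1..N}. - ?g)"
    by (rule sum.cong[OF refl])
  then show ?thesis unfolding flip_average_def c fermion_prod_apply[OF f]
    using N(2) by (intro ext) (simp add: tscale_def tensor_sum_apply del: upt_Suc)
qed

text \<open>Both maps are linear and agree on the generators, so span induction applies.\<close>

lemma flip_eq_flip_average:
  assumes n: "n \<ge> 1" and lin: "linear_map_on (F_space n) (F_space n) \<tau>"
    and id: "\<tau> (fock_id (2 * n)) = fock_id (2 * n)"
    and ferm: "\<forall>j\<in>{1..2 * n}. \<tau> (fermion (2 * n) j) = fermion (2 * n) j"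
    and prod: "\<tau> (fermion_prod (2 * n)) = - fermion_prod (2 * n)"
    and T: "T \<in> F_space n"
  shows "T \<in> fock_ops (2 * n) \<and> (\<forall>f\<in>fock (2 * n). \<tau> T f = flip_average (2 * n) T f)"
proof -
  let ?N = "2 * n"
  \<comment> \<open>Linearity of \<open>\<tau>\<close> is known only on \<open>F_space n\<close>,
    and additivity of \<open>flip_average\<close> only on \<open>fock_ops\<close>; both memberships
    therefore accompany the induction.\<close>
  let ?P = "\<lambda>T. T \<in> F_space n \<and> T \<in> fock_ops ?N \<and> (\<forall>f\<in>fock ?N. \<tau> T f = flip_average ?N T f)"
  note D = linear_map_onD[OF lin]
  have scale: "?P (oscale c T)" if "?P T" for c T
    using that by (auto intro: F_space_oscale fock_ops_oscale
        simp: D(2) flip_average_oscale oscale_def[of c "\<tau> T"])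
  have add: "?P (S + T)" if "?P S" "?P T" for S T
  proof -
    have "\<tau> (S + T) f = flip_average ?N (S + T) f" if f: "f \<in> fock ?N" for f
      using \<open>?P S\<close> \<open>?P T\<close> f by (simp only: D(1) flip_average_add plus_fun_apply[of "\<tau> S"])
    then show ?thesis using \<open>?P S\<close> \<open>?P T\<close> F_space_add fock_ops_plus by blast
  qed
  have gen: "?P T" if T: "T \<in> {fock_id ?N} \<union> fermion ?N ` {1..?N} \<union> {fermion_prod ?N}" for T
  proof -
    consider "T = fock_id ?N" | j where "j \<in> {1..?N}" "T = fermion ?N j" | "T = fermion_prod ?N"
      using T by blast
    then show ?thesis
    proof cases
      case 1
      then show ?thesis using n by (simp add: F_space_generators fock_id_fock_ops id flip_average_id, simp add: fock_id_def)
    next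
      case 2
      then show ?thesis using n flip_average_fermion[of ?N j]
        by (simp only: F_space_generators fermion_fock_ops ferm[rule_format]) simp
    next
      case 3
      then show ?thesis using n flip_average_fermion_prod[of ?N]
        by (simp only: F_space_generators fermion_prod_fock_ops prod) simp
    qed
  qed
  have zero: "?P 0" 
  proof -
    have "?P (oscale 0 (fock_id ?N))" by (rule scale[OF gen]) simp
    then show ?thesis unfolding operators.scale_zero_left .
  qed
  define Q where "Q T \<longleftrightarrow> ?P T" for T
  have "operators.subspace (Collect Q)"
    unfolding operators.subspace_def mem_Collect_eq Q_def using zero add scale by (intro conjI ballI allI) simp_all
  moreover have "\<And>S. S \<in> {fock_id ?N} \<union> fermion ?N ` {1..?N} \<union> {fermion_prod ?N} \<Longrightarrow> Q S"
    unfolding Q_def by (rule gen)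
  ultimately have "Q T" using operators.span_induct[OF T[unfolded F_space_def], of Q] by blast
  then show ?thesis unfolding Q_def by blast
qed

text \<open>With \<open>N = 2 * n\<close>, the flipped matrix is \<open>1 / N\<close> times a signed
  sum of \<open>N + 2\<close> unitary conjugates of \<open>a\<close>, each of norm at most
  1.\<close>

lemma mat_norm_flip_le:
  assumes n: "n \<ge> 1" and lin: "linear_map_on (F_space n) (F_space n) \<tau>"
    and id: "\<tau> (fock_id (2 * n)) = fock_id (2 * n)"
    and ferm: "\<forall>j\<in>{1..2 * n}. \<tau> (fermion (2 * n) j) = fermion (2 * n) j"
    and prod: "\<tau> (fermion_prod (2 * n)) = - fermion_prod (2 * n)"
    and a: "a \<in> mats k (F_space n)" "mat_norm (2 * n) k a \<le> 1"
  shows "mat_norm (2 * n) k (\<lambda>i j. \<tau> (a i j)) \<le> ereal ((real n + 1) / real n)"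
  unfolding mat_norm_def
proof (rule SUP_least)
  let ?N = "2 * n" let ?L = "full ?N"
  fix x assume "x \<in> {x. (\<forall>j<k. x j \<in> fock ?N) \<and> column_norm ?N k x \<le> 1}"
  then have x: "\<And>j. j < k \<Longrightarrow> x j \<in> fock ?N" and x1: "column_norm ?N k x \<le> 1" by auto
  have aij: "a i j \<in> F_space n" if "i < k" "j < k" for i j using a(1) that by (simp add: mats_def)
  note flip = flip_eq_flip_average[OF n lin id ferm prod aij]
  \<comment> \<open>The conjugated matrix applied to \<open>x\<close>. The same word acts on every
    entry, so it is an isometry of columns; \<open>y []\<close> covers the unconjugated
    term.\<close>
  define y where "y js i = word ?N js (\<Sum>j<k. a i j (word ?N (rev js) (x j)))" for js i
  have y1: "column_norm ?N k (y js) \<le> 1" if js: "set js \<subseteq> {1..?N}" for js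
  proof -
    have rev: "set (rev js) \<subseteq> {1..?N}" using js by simp
    have "column_norm ?N k (y js) = column_norm ?N k (\<lambda>i. \<Sum>j<k. a i j (word ?N (rev js) (x j)))"
      unfolding y_def using flip by (intro column_norm_word[OF js] fock_sum) (auto intro: fock_ops_in)
    also have "\<dots> \<le> 1"
      by (rule mat_normD[OF a(2)]) (simp_all only: column_norm_word[OF rev x] x1 word_in[OF rev x])
    finally show ?thesis .
  qed
  have y: "y js i = (\<Sum>j<k. conjugate ?N js (a i j) (x j))" if "set js \<subseteq> {1..?N}" "i < k" for js i
    unfolding y_def conjugate_def using flip that(2) by (intro word_sum[OF that(1)]) (auto intro: fock_ops_in)
  have "(\<Sum>j<k. \<tau> (a i j) (x j))
      = cscale (1 / of_nat ?N) ((\<Sum>t\<in>{1..?N}. y (?L @ [t])) + y [] + cscale (- 1) (y ?L)) i" if i: "i < k" for i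
  proof -
    have "(\<Sum>j<k. \<tau> (a i j) (x j)) = (\<Sum>j<k. flip_average ?N (a i j) (x j))"
      using flip[OF i] x by (intro sum.cong) auto
    also have "\<dots> = tscale (1 / of_nat ?N)
        ((\<Sum>t\<in>{1..?N}. \<Sum>j<k. conjugate ?N (?L @ [t]) (a i j) (x j))
          + (\<Sum>j<k. conjugate ?N [] (a i j) (x j)) - (\<Sum>j<k. conjugate ?N ?L (a i j) (x j)))"
      unfolding flip_average_def tscale_sum[symmetric] sum_subtractf sum.distrib
      by (subst sum.swap) (simp add: conjugate_def del: upt_Suc)
    also have "(\<Sum>t\<in>{1..?N}. \<Sum>j<k. conjugate ?N (?L @ [t]) (a i j) (x j)) = (\<Sum>t\<in>{1..?N}. y (?L @ [t]) i)"
      by (intro sum.cong refl y[OF full_snoc_subset i, symmetric])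
    also have "(\<Sum>j<k. conjugate ?N [] (a i j) (x j)) = y [] i" by (rule y[symmetric]) (simp_all add: i)
    also have "(\<Sum>j<k. conjugate ?N ?L (a i j) (x j)) = y ?L i" by (rule y[OF full_subset i, symmetric])
    finally show ?thesis
      by (simp only: cscale_apply plus_fun_apply[of _ _ i] sum_fun_apply[of "\<lambda>t. y (?L @ [t])"]
          tscale_minus_one add_uminus_conv_diff)
  qed
  then have "column_norm ?N k (\<lambda>i. \<Sum>j<k. \<tau> (a i j) (x j)) =
      column_norm ?N k (cscale (1 / of_nat ?N) ((\<Sum>t\<in>{1..?N}. y (?L @ [t])) + y [] + cscale (- 1) (y ?L)))"
    by (rule column_norm_cong)
  also have "\<dots> = (1 / real ?N) * column_norm ?N k ((\<Sum>t\<in>{1..?N}. y (?L @ [t])) + y [] + cscale (- 1) (y ?L))"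
    unfolding column_norm_cscale by (simp add: norm_divide norm_mult)
  also have "\<dots> \<le> (1 / real ?N) * (real ?N + 1 + 1)"
  proof (intro mult_left_mono)
    have "column_norm ?N k (\<Sum>t\<in>{1..?N}. y (?L @ [t])) \<le> (\<Sum>t\<in>{1..?N}. 1)"
      by (rule order_trans[OF column_norm_sum]) (intro sum_mono y1 full_snoc_subset)
    moreover have "column_norm ?N k (y []) \<le> 1" by (rule y1) simp
    moreover have "column_norm ?N k (cscale (- 1) (y ?L)) \<le> 1"
      unfolding column_norm_cscale using y1[OF full_subset] by simp
    ultimately show "column_norm ?N k ((\<Sum>t\<in>{1..?N}. y (?L @ [t])) + y [] + cscale (- 1) (y ?L)) \<le> real ?N + 1 + 1"
      using column_norm_triangle[of ?N k "(\<Sum>t\<in>{1..?N}. y (?L @ [t])) + y []" "cscale (- 1) (y ?L)"]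
        column_norm_triangle[of ?N k "\<Sum>t\<in>{1..?N}. y (?L @ [t])" "y []"]
      by simp
  qed (use n in simp)
  also have "\<dots> = (real n + 1) / real n" using n by (simp add: field_simps)
  finally show "ereal (column_norm ?N k (\<lambda>i. \<Sum>j<k. \<tau> (a i j) (x j))) \<le> ereal ((real n + 1) / real n)"
    by simp
qed

theorem proposition7p1:
  fixes n :: nat and \<tau> :: "oper \<Rightarrow> oper"
  assumes "n \<ge> 1"
    and "linear_map_on (F_space n) (F_space n) \<tau>"
    and "\<tau> (fock_id (2 * n)) = fock_id (2 * n)"
    and "\<forall>j\<in>{1..2 * n}. \<tau> (fermion (2 * n) j) = fermion (2 * n) j"
    and "\<tau> (fermion_prod (2 * n)) = - fermion_prod (2 * n)"
  shows "cb_norm (2 * n) (F_space n) \<tau> = ereal ((real n + 1) / real n)"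
proof (rule antisym)
  let ?N = "2 * n"
  show "cb_norm ?N (F_space n) \<tau> \<le> ereal ((real n + 1) / real n)"
    unfolding cb_norm_def amplification_norm_def
    by (intro SUP_least mat_norm_flip_le[OF assms]) auto
  \<comment> \<open>The flips use bit positions 1 to \<open>2 * n\<close>, so indices need
    \<open>2 * n + 1\<close> bits.\<close>
  let ?k = "2 ^ Suc ?N"
  have N: "even ?N" "?N > 0" using assms(1) by auto
  have "ereal ((real n + 1) / real n) = ereal ((real ?N + 2) / real ?N)"
    using assms(1) by (simp add: field_simps)
  also have "\<dots> \<le> mat_norm ?N ?k (test_matrix ?N (- 1))"
    by (rule mat_norm_test_matrix_ge[OF N]) simp
  also have "test_matrix ?N (- 1) = (\<lambda>i j. \<tau> (test_matrix ?N 1 i j))"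
    by (intro ext[of "test_matrix ?N (- 1)"] ext) (simp only: flip_test_matrix[OF assms(2-5)])
  also have "mat_norm ?N ?k \<dots> \<le> amplification_norm ?N (F_space n) \<tau> ?k"
    unfolding amplification_norm_def
    by (rule SUP_upper) (use mat_norm_test_matrix_le[OF N, of "Suc ?N"] in \<open>simp add: mats_def test_matrix_in\<close>)
  also have "\<dots> \<le> cb_norm ?N (F_space n) \<tau>"
    unfolding cb_norm_def by (rule SUP_upper) simp
  finally show "ereal ((real n + 1) / real n) \<le> cb_norm ?N (F_space n) \<tau>" .
qed

end
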